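(* Let $K$ be a finite connected two-dimensional CW complex with fundamental group $\Pi$ such that $H^2(K;\mathbb{Z})$ is finite of odd order. Then for every homomorphism $\alpha\in\hom(\Pi;\mathbb{Z}_2)$ there exists a non-surjective map $f_0:K\to\mathbb{R}P^2$ inducing $\alpha$ on fundamental groups.
   Context: $\pi_1(\mathbb{R}P^2)$ is identified with $\mathbb{Z}_2$, the cyclic group of order two. *)

theory Defs
  imports "HOL-Analysis.Analysis" "HOL-Homology.Homology"
begin

text \<open>Closed unit disk, open unit ball and boundary sphere of dimension n, realised
  inside the product space (nat => real) with all coordinates of index >= n equal to zero
  (the same ambient space HOL-Homology uses for standard simplices).\<close>

definition cw_disk :: "nat \<Rightarrow> (nat \<Rightarrow> real) set" where
  "cw_disk n = {x. (\<forall>i\<ge>n. x i = 0) \<and> (\<Sum>i<n. (x i)\<^sup>2) \<le> 1}"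

definition cw_ball :: "nat \<Rightarrow> (nat \<Rightarrow> real) set" where
  "cw_ball n = {x. (\<forall>i\<ge>n. x i = 0) \<and> (\<Sum>i<n. (x i)\<^sup>2) < 1}"

definition cw_sphere :: "nat \<Rightarrow> (nat \<Rightarrow> real) set" where
  "cw_sphere n = {x. (\<forall>i\<ge>n. x i = 0) \<and> (\<Sum>i<n. (x i)\<^sup>2) = 1}"

text \<open>A finite CW structure of dimension at most d on a space K: a finite family of cells,
  each given by its dimension n and its characteristic map Phi from the closed n-disk,
  such that K is Hausdorff, the open cells Phi(open ball) partition K, each characteristic
  map is continuous and injective on the open ball, and maps the boundary sphere into the
  union of cells of lower dimension. (For finite complexes the closure-finiteness and
  weak topology conditions are automatic.)\<close>

definition finite_CW_complex :: "nat \<Rightarrow> 'a topology \<Rightarrow> bool" where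
  "finite_CW_complex d K \<longleftrightarrow> Hausdorff_space K \<and>
     (\<exists>C :: (nat \<times> ((nat \<Rightarrow> real) \<Rightarrow> 'a)) set. finite C \<and>
        (\<forall>(n, \<Phi>) \<in> C. n \<le> d \<and>
           continuous_map (subtopology (powertop_real UNIV) (cw_disk n)) K \<Phi> \<and>
           inj_on \<Phi> (cw_ball n) \<and>
           \<Phi> ` cw_sphere n \<subseteq> \<Union> {\<Psi> ` cw_ball m | m \<Psi>. (m, \<Psi>) \<in> C \<and> m < n}) \<and>
        (\<forall>x \<in> topspace K. \<exists>!c \<in> C. x \<in> snd c ` cw_ball (fst c)))"

definition cochains :: "'a topology \<Rightarrow> nat \<Rightarrow> (((nat \<Rightarrow> real) \<Rightarrow> 'a) \<Rightarrow> int) set" where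
  "cochains K n = {c. \<forall>\<sigma>. \<not> singular_simplex n K \<sigma> \<longrightarrow> c \<sigma> = 0}"

definition coboundary :: "'a topology \<Rightarrow> nat \<Rightarrow> (((nat \<Rightarrow> real) \<Rightarrow> 'a) \<Rightarrow> int)
                           \<Rightarrow> ((nat \<Rightarrow> real) \<Rightarrow> 'a) \<Rightarrow> int" where
  "coboundary K n c = (\<lambda>\<sigma>. if singular_simplex (Suc n) K \<sigma>
       then (\<Sum>i\<le>Suc n. (-1) ^ i * c (singular_face (Suc n) i \<sigma>)) else 0)"

definition cocycles :: "'a topology \<Rightarrow> nat \<Rightarrow> (((nat \<Rightarrow> real) \<Rightarrow> 'a) \<Rightarrow> int) set" where
  "cocycles K n = {c \<in> cochains K n. coboundary K n c = (\<lambda>\<sigma>. 0)}"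

definition coboundaries :: "'a topology \<Rightarrow> nat \<Rightarrow> (((nat \<Rightarrow> real) \<Rightarrow> 'a) \<Rightarrow> int) set" where
  "coboundaries K n = (if n = 0 then {\<lambda>\<sigma>. 0} else coboundary K (n - 1) ` cochains K (n - 1))"

definition cohomology_group :: "'a topology \<Rightarrow> nat \<Rightarrow> (((nat \<Rightarrow> real) \<Rightarrow> 'a) \<Rightarrow> int) set set" where
  "cohomology_group K n =
     cocycles K n // {(c, c'). c \<in> cocycles K n \<and> c' \<in> cocycles K n \<and>
                               (\<lambda>\<sigma>. c \<sigma> - c' \<sigma>) \<in> coboundaries K n}"

definition RP2_points :: "(real^3) set set" where
  "RP2_points = {{v, -v} | v. v \<in> sphere 0 1}"

lemma RP2_points_disjoint:
  assumes "P \<in> RP2_points" "Q \<in> RP2_points" "x \<in> P" "x \<in> Q" shows "P = Q"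
proof -
  obtain v where v: "P = {v, -v}" using assms(1) unfolding RP2_points_def by blast
  obtain w where w: "Q = {w, -w}" using assms(2) unfolding RP2_points_def by blast
  have "P = {x, -x}" using v assms(3) by auto
  moreover have "Q = {x, -x}" using w assms(4) by auto
  ultimately show ?thesis by simp
qed
lemma Union_Int_RP2:
  assumes "S \<subseteq> RP2_points" "T \<subseteq> RP2_points"
  shows "\<Union>(S \<inter> T) = \<Union>S \<inter> \<Union>T"
proof
  show "\<Union>(S \<inter> T) \<subseteq> \<Union>S \<inter> \<Union>T" by (rule Union_Int_subset)
  show "\<Union>S \<inter> \<Union>T \<subseteq> \<Union>(S \<inter> T)"
  proof
    fix x assume "x \<in> \<Union>S \<inter> \<Union>T"
    then obtain P Q where PQ: "P \<in> S" "Q \<in> T" "x \<in> P" "x \<in> Q" by auto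
    then have "P = Q" using assms RP2_points_disjoint[of P Q x] by (meson subsetD)
    then show "x \<in> \<Union>(S \<inter> T)" using PQ by auto
  qed
qed
lemma istopology_RP2:
  "istopology (\<lambda>U. U \<subseteq> RP2_points \<and> openin (top_of_set (sphere (0::real^3) 1)) (\<Union>U))"
  unfolding istopology_def
proof (rule conjI; intro allI impI)
  fix S T :: "(real^3) set set"
  assume a: "S \<subseteq> RP2_points \<and> openin (top_of_set (sphere (0::real^3) 1)) (\<Union>S)"
     and b: "T \<subseteq> RP2_points \<and> openin (top_of_set (sphere (0::real^3) 1)) (\<Union>T)"
  have e: "\<Union>(S \<inter> T) = \<Union>S \<inter> \<Union>T"
    using a b Union_Int_RP2 by simp
  show "S \<inter> T \<subseteq> RP2_points \<and> openin (top_of_set (sphere (0::real^3) 1)) (\<Union>(S \<inter> T))"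
    unfolding e using a b by (simp add: le_infI1 openin_Int)
next
  fix \<K> :: "(real^3) set set set"
  assume k: "\<forall>K\<in>\<K>. K \<subseteq> RP2_points \<and> openin (top_of_set (sphere (0::real^3) 1)) (\<Union>K)"
  have e: "\<Union>(\<Union>\<K>) = \<Union>(Union ` \<K>)" by auto
  have "openin (top_of_set (sphere (0::real^3) 1)) (\<Union>(Union ` \<K>))"
    using k by (intro openin_Union) auto
  moreover have "\<Union>\<K> \<subseteq> RP2_points" using k by (simp add: Sup_le_iff)
  ultimately show "\<Union>\<K> \<subseteq> RP2_points \<and> openin (top_of_set (sphere (0::real^3) 1)) (\<Union>(\<Union>\<K>))"
    using e by simp
qed

definition RP2 :: "(real^3) set topology" where
  "RP2 = topology (\<lambda>U. U \<subseteq> RP2_points \<and> openin (top_of_set (sphere (0::real^3) 1)) (\<Union>U))"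

definition loopin :: "'a topology \<Rightarrow> 'a \<Rightarrow> (real \<Rightarrow> 'a) \<Rightarrow> bool" where
  "loopin X x0 g \<longleftrightarrow> pathin X g \<and> g 0 = x0 \<and> g 1 = x0"

definition loop_join :: "(real \<Rightarrow> 'a) \<Rightarrow> (real \<Rightarrow> 'a) \<Rightarrow> real \<Rightarrow> 'a" where
  "loop_join g1 g2 = (\<lambda>t. if t \<le> 1/2 then g1 (2 * t) else g2 (2 * t - 1))"

definition homotopic_loops_rel :: "'a topology \<Rightarrow> 'a \<Rightarrow> (real \<Rightarrow> 'a) \<Rightarrow> (real \<Rightarrow> 'a) \<Rightarrow> bool" where
  "homotopic_loops_rel X x0 p q \<longleftrightarrow>
     homotopic_with (\<lambda>h. h 0 = x0 \<and> h 1 = x0) (top_of_set {0..1}) X p q"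

text \<open>A homomorphism pi_1(X, x0) -> Z_2, with Z_2 = bool under exclusive or (True = generator):
  a function on loops at x0, constant on based homotopy classes, sending
  concatenation to the sum.\<close>
definition pi1_hom_Z2 :: "'a topology \<Rightarrow> 'a \<Rightarrow> ((real \<Rightarrow> 'a) \<Rightarrow> bool) \<Rightarrow> bool" where
  "pi1_hom_Z2 X x0 \<alpha> \<longleftrightarrow>
     (\<forall>p q. loopin X x0 p \<and> loopin X x0 q \<and> homotopic_loops_rel X x0 p q \<longrightarrow> \<alpha> p = \<alpha> q) \<and>
     (\<forall>p q. loopin X x0 p \<and> loopin X x0 q \<longrightarrow> \<alpha> (loop_join p q) = (\<alpha> p \<noteq> \<alpha> q))"

text \<open>f : K -> RP^2 induces alpha on fundamental groups (pi_1(RP^2) identified with Z_2,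
  the non-trivial element being the class of a non-nullhomotopic loop).\<close>
definition induces_on_pi1 :: "'a topology \<Rightarrow> 'a \<Rightarrow> ('a \<Rightarrow> (real^3) set) \<Rightarrow> ((real \<Rightarrow> 'a) \<Rightarrow> bool) \<Rightarrow> bool" where
  "induces_on_pi1 K x0 f \<alpha> \<longleftrightarrow>
     (\<forall>\<gamma>. loopin K x0 \<gamma> \<longrightarrow>
        (\<alpha> \<gamma> \<longleftrightarrow> \<not> homotopic_loops_rel RP2 (f x0) (f \<circ> \<gamma>) (\<lambda>t. f x0)))"

end

theory Submission
  imports Defs
begin

text \<open>A homomorphism from the fundamental group to the group of order two is a mod 2 class of
  degree one, and its Bockstein is a 2-torsion class in integral cohomology of degree two. Since
  that group has odd order, the Bockstein vanishes and the class lifts to an integral 1-cocycle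
  \<open>z\<close>. An integral 1-cocycle on a finite 2-complex is represented by a map to the circle, which is
  built over the skeleta: the boundary of each 2-cell is null-homotopic, so \<open>z\<close> vanishes on it and
  the map extends radially. Composing with the inclusion of a projective line gives a map to the
  projective plane that misses a point; a loop is sent to \<open>z\<close> half turns, and these are
  null-homotopic exactly if \<open>z\<close> is even on the loop.\<close>

section \<open>Path homotopy in abstract spaces\<close>

text \<open>The singular cocycle \<open>z\<close> has a value on every path, also on paths that
  cross cell boundaries infinitely often, so a map built cell by cell must be compared with
  \<open>z\<close> on paths of no cellular shape. The induction over the skeleta therefore carries a
  real function \<open>F\<close>, possibly discontinuous, such that \<open>F\<close> plus the value
  of \<open>z\<close> is continuous along every path. As \<open>z\<close> is integral, that summand
  does not change \<open>F\<close> modulo 1, so this one invariant ties the circle-valued map to the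
  class it represents. On a cell, \<open>F\<close> is a continuous function \<open>h\<close> minus
  the value of \<open>z\<close> on the radius, and the previous stage fixes \<open>h\<close> on the
  boundary sphere. The invariant is checked locally in time: near a given moment a path either stays
  in one open cell or can be pushed into the lower skeleton.\<close>

lemma continuous_map_compose_on:
  assumes "continuous_map (top_of_set S) X G" "continuous_on A u" "u \<in> A \<rightarrow> S"
  shows "continuous_map (top_of_set A) X (\<lambda>t. G (u t))"
proof -
  have "continuous_map (top_of_set A) (top_of_set S) u"
    using assms by auto
  from continuous_map_compose[OF this assms(1)] show ?thesis by (simp add: o_def)
qed

lemma continuous_map_cases_le_on:
  fixes f g :: "'b::topological_space \<Rightarrow> 'a" and p q :: "'b \<Rightarrow> real"
  assumes "continuous_on A p" "continuous_on A q"
    and "continuous_map (top_of_set {x \<in> A. p x \<le> q x}) X f"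
    and "continuous_map (top_of_set {x \<in> A. q x \<le> p x}) X g"
    and "\<And>x. x \<in> A \<Longrightarrow> p x = q x \<Longrightarrow> f x = g x"
  shows "continuous_map (top_of_set A) X (\<lambda>x. if p x \<le> q x then f x else g x)"
proof (rule continuous_map_cases_le)
  have *: "A \<inter> {x \<in> A. R x} = {x \<in> A. R x}" for R by auto
  show "continuous_map (subtopology (top_of_set A) {x \<in> topspace (top_of_set A). p x \<le> q x}) X f"
    "continuous_map (subtopology (top_of_set A) {x \<in> topspace (top_of_set A). q x \<le> p x}) X g"
    using assms by (simp_all add: subtopology_subtopology *)
qed (use assms in auto)

text \<open>\<open>homotopic_loops_rel\<close> speaks of loops at one point only. This version fixes
  the endpoints of arbitrary paths and asks for agreement on the unit interval alone.\<close>

definition path_homotopic :: "'a topology \<Rightarrow> (real \<Rightarrow> 'a) \<Rightarrow> (real \<Rightarrow> 'a) \<Rightarrow> bool" where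
  "path_homotopic X p q \<longleftrightarrow>
     (\<exists>h. continuous_map (top_of_set ({0..1::real} \<times> {0..1::real})) X h \<and>
       (\<forall>t\<in>{0..1}. h (0, t) = p t \<and> h (1, t) = q t) \<and>
       (\<forall>s\<in>{0..1}. h (s, 0) = p 0 \<and> h (s, 1) = p 1))"

lemma path_homotopic_imp_homotopic_loops_rel:
  assumes "path_homotopic X p q" "p 0 = x0" "p 1 = x0"
  shows "homotopic_loops_rel X x0 p q"
proof -
  obtain h where "continuous_map (top_of_set ({0..1::real} \<times> {0..1::real})) X h"
    "\<forall>t\<in>{0..1}. h (0, t) = p t \<and> h (1, t) = q t"
    "\<forall>s\<in>{0..1}. h (s, 0) = p 0 \<and> h (s, 1) = p 1"
    using assms(1) unfolding path_homotopic_def by blast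
  then show ?thesis
    unfolding homotopic_loops_rel_def using assms
    by (subst homotopic_with) (auto intro!: exI[of _ h] simp: prod_topology_subtopology_eu)
qed

lemma path_homotopic_refl:
  assumes "pathin X p"
  shows "path_homotopic X p p"
proof -
  have "continuous_map (top_of_set ({0..1::real} \<times> {0..1})) X (\<lambda>z. p (snd z))"
    using assms unfolding pathin_def
    by (rule continuous_map_compose_on) (auto intro!: continuous_intros)
  then show ?thesis
    unfolding path_homotopic_def by (intro exI[of _ "\<lambda>z. p (snd z)"]) simp
qed

text \<open>The straight-line homotopy inside \<open>S\<close>, pushed forward by \<open>G\<close>.
  Reparametrisations, cancellations and triangles are all obtained from it.\<close>

lemma path_homotopic_via_convex:
  fixes G :: "'b::real_normed_vector \<Rightarrow> 'a"
  assumes G: "continuous_map (top_of_set S) X G" "convex S"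
    and u: "continuous_on {0..1} u" "u \<in> {0..1} \<rightarrow> S"
    and v: "continuous_on {0..1} v" "v \<in> {0..1} \<rightarrow> S"
    and ends: "u 0 = v 0" "u 1 = v 1"
    and p: "\<And>t. t \<in> {0..1} \<Longrightarrow> p t = G (u t)" and q: "\<And>t. t \<in> {0..1} \<Longrightarrow> q t = G (v t)"
  shows "path_homotopic X p q"
proof -
  define w where "w = (\<lambda>z::real\<times>real. (1 - fst z) *\<^sub>R u (snd z) + fst z *\<^sub>R v (snd z))"
  have "continuous_on ({0..1} \<times> {0..1}) w"
    unfolding w_def
    by (intro continuous_intros continuous_on_compose2[OF u(1)] continuous_on_compose2[OF v(1)]) auto
  moreover have "w \<in> {0..1} \<times> {0..1} \<rightarrow> S"
    using u v \<open>convex S\<close> by (auto simp: w_def convex_def Pi_iff)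
  ultimately have "continuous_map (top_of_set ({0..1} \<times> {0..1})) X (\<lambda>z. G (w z))"
    by (rule continuous_map_compose_on[OF G(1)])
  moreover have "w (s, 0) = u 0" "w (s, 1) = u 1" for s
    by (simp_all add: w_def ends scaleR_left_diff_distrib)
  ultimately show ?thesis
    unfolding path_homotopic_def using p q
    by (intro exI[of _ "\<lambda>z. G (w z)"]) (auto simp: w_def)
qed

lemma pathin_loop_join:
  assumes "pathin X p" "pathin X q" "p 1 = q 0"
  shows "pathin X (loop_join p q)"
  unfolding pathin_def loop_join_def
proof (rule continuous_map_cases_le_on)
  show "continuous_map (top_of_set {x \<in> {0..1}. x \<le> 1/2}) X (\<lambda>t. p (2 * t))"
    using assms(1) unfolding pathin_def
    by (rule continuous_map_compose_on) (auto intro!: continuous_intros)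
  show "continuous_map (top_of_set {x \<in> {0..1}. 1/2 \<le> x}) X (\<lambda>t. q (2 * t - 1))"
    using assms(2) unfolding pathin_def
    by (rule continuous_map_compose_on) (auto intro!: continuous_intros)
  show "p (2 * x) = q (2 * x - 1)" if "x = 1/2" for x
    using that by hypsubst (simp add: assms(3))
qed (auto intro!: continuous_intros)

lemma pathin_reverse: "pathin X p \<Longrightarrow> pathin X (\<lambda>t. p (1 - t))"
  unfolding pathin_def
  by (rule continuous_map_compose_on) (auto intro!: continuous_intros)

lemma loop_join_0 [simp]: "loop_join p q 0 = p 0"
  and loop_join_1 [simp]: "loop_join p q 1 = q 1"
  by (simp_all add: loop_join_def)

lemma path_homotopic_join:
  assumes "path_homotopic X p p'" "path_homotopic X q q'" "p 1 = q 0"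
  shows "path_homotopic X (loop_join p q) (loop_join p' q')"
proof -
  obtain h where h: "continuous_map (top_of_set ({0..1::real} \<times> {0..1::real})) X h"
    "\<forall>t\<in>{0..1}. h (0, t) = p t \<and> h (1, t) = p' t"
    "\<forall>s\<in>{0..1}. h (s, 0) = p 0 \<and> h (s, 1) = p 1"
    using assms(1) unfolding path_homotopic_def by blast
  obtain k where k: "continuous_map (top_of_set ({0..1::real} \<times> {0..1::real})) X k"
    "\<forall>t\<in>{0..1}. k (0, t) = q t \<and> k (1, t) = q' t"
    "\<forall>s\<in>{0..1}. k (s, 0) = q 0 \<and> k (s, 1) = q 1"
    using assms(2) unfolding path_homotopic_def by blast
  define H where "H z = (if snd z \<le> 1/2 then h (fst z, 2 * snd z) else k (fst z, 2 * snd z - 1))"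
    for z :: "real \<times> real"
  have "continuous_map (top_of_set ({0..1} \<times> {0..1})) X H"
    unfolding H_def
  proof (rule continuous_map_cases_le_on)
    show "continuous_map (top_of_set {x \<in> {0..1} \<times> {0..1}. snd x \<le> 1/2}) X
        (\<lambda>z. h (fst z, 2 * snd z))"
      using h(1) by (rule continuous_map_compose_on) (auto intro!: continuous_intros)
    show "continuous_map (top_of_set {x \<in> {0..1} \<times> {0..1}. 1/2 \<le> snd x}) X
        (\<lambda>z. k (fst z, 2 * snd z - 1))"
      using k(1) by (rule continuous_map_compose_on) (auto intro!: continuous_intros)
    show "h (fst z, 2 * snd z) = k (fst z, 2 * snd z - 1)"
      if "z \<in> {0..1} \<times> {0..1}" "snd z = 1/2" for z
    proof -
      have "2 * snd z = 1" "fst z \<in> {0..1}" using that by auto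
      then show ?thesis using h(3) k(3) assms(3) by simp
    qed
  qed (intro continuous_intros)+
  moreover have "H (0, t) = loop_join p q t \<and> H (1, t) = loop_join p' q' t" if "t \<in> {0..1}" for t
    using that h(2)[rule_format, of "2 * t"] k(2)[rule_format, of "2 * t - 1"]
    by (simp add: H_def loop_join_def)
  moreover have "H (s, 0) = loop_join p q 0 \<and> H (s, 1) = loop_join p q 1" if "s \<in> {0..1}" for s
    using that h(3) k(3) by (auto simp: H_def)
  ultimately show ?thesis
    unfolding path_homotopic_def by blast
qed

text \<open>With the three paths laid end to end over \<open>{0..3}\<close>, the two bracketings are
  reparametrisations of one path. The first runs at speed 4 and then 2, the second at speed 2 and
  then 4, hence the \<open>min\<close> and the \<open>max\<close>.\<close>

lemma path_homotopic_assoc: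
  assumes "pathin X p" "pathin X q" "pathin X r" "p 1 = q 0" "q 1 = r 0"
  shows "path_homotopic X (loop_join (loop_join p q) r) (loop_join p (loop_join q r))"
proof -
  define G where "G = (\<lambda>t. if t \<le> 1 then p t else if t \<le> 2 then q (t - 1) else r (t - 2))"
  have "continuous_map (top_of_set {x \<in> {0..3}. 1 \<le> x}) X
      (\<lambda>t. if t \<le> 2 then q (t - 1) else r (t - 2))"
  proof (rule continuous_map_cases_le_on)
    show "continuous_map (top_of_set {x \<in> {x \<in> {0..3}. 1 \<le> x}. x \<le> 2}) X (\<lambda>t. q (t - 1))"
      using assms(2) unfolding pathin_def
      by (rule continuous_map_compose_on) (auto intro!: continuous_intros)
    show "continuous_map (top_of_set {x \<in> {x \<in> {0..3}. 1 \<le> x}. 2 \<le> x}) X (\<lambda>t. r (t - 2))"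
      using assms(3) unfolding pathin_def
      by (rule continuous_map_compose_on) (auto intro!: continuous_intros)
  qed (use assms in \<open>auto intro!: continuous_intros\<close>)
  moreover have "continuous_map (top_of_set {x \<in> {0..3}. x \<le> 1}) X p"
    using assms(1) unfolding pathin_def
    by (rule continuous_map_compose_on) (auto intro!: continuous_intros)
  ultimately have G: "continuous_map (top_of_set {0..3}) X G"
    unfolding G_def
    by (intro continuous_map_cases_le_on[of "{0..3}" "\<lambda>t. t" "\<lambda>t. 1" X p]) (auto simp: assms)
  show ?thesis
  proof (rule path_homotopic_via_convex[OF G, of "\<lambda>t. min (4 * t) (2 * t + 1)"
        "\<lambda>t. max (2 * t) (4 * t - 1)"])
    show "continuous_on {0..1} (\<lambda>t::real. min (4 * t) (2 * t + 1))"
      "continuous_on {0..1} (\<lambda>t::real. max (2 * t) (4 * t - 1))"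
      by (intro continuous_intros)+
    fix t :: real
    consider "t < 1/2" | "t = 1/2" | "1/2 < t" by linarith
    note cases = this
    show "loop_join (loop_join p q) r t = G (min (4 * t) (2 * t + 1))"
      by (rule cases) (simp_all add: loop_join_def G_def min_def)
    show "loop_join p (loop_join q r) t = G (max (2 * t) (4 * t - 1))"
      by (rule cases; hypsubst?; simp add: loop_join_def G_def max_def)
  qed (auto simp: min_def max_def)
qed

lemma path_homotopic_reverse_join:
  assumes "pathin X p"
  shows "path_homotopic X (loop_join (\<lambda>t. p (1 - t)) p) (\<lambda>t. p 1)"
proof (rule path_homotopic_via_convex[of "{0..1}" X p "\<lambda>t. \<bar>1 - 2 * t\<bar>" "\<lambda>t. 1"])
  show "loop_join (\<lambda>t. p (1 - t)) p t = p \<bar>1 - 2 * t\<bar>" for t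
    by (simp add: loop_join_def abs_if)
  show "continuous_on {0..1} (\<lambda>t::real. \<bar>1 - 2 * t\<bar>)" by (intro continuous_intros)
qed (use assms in \<open>auto simp: pathin_def\<close>)

lemma path_homotopic_join_reverse:
  assumes "pathin X p"
  shows "path_homotopic X (loop_join p (\<lambda>t. p (1 - t))) (\<lambda>t. p 0)"
proof -
  have "path_homotopic X (loop_join (\<lambda>t. p (1 - (1 - t))) (\<lambda>t. p (1 - t))) (\<lambda>t. p (1 - 1))"
    using pathin_reverse[OF assms] by (rule path_homotopic_reverse_join)
  then show ?thesis by simp
qed

lemma path_homotopic_const_join:
  assumes "pathin X p" "p 0 = x"
  shows "path_homotopic X (loop_join (\<lambda>t. x) p) p"
proof (rule path_homotopic_via_convex[of "{0..1}" X p "\<lambda>t. max 0 (2 * t - 1)" "\<lambda>t. t"])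
  show "loop_join (\<lambda>t. x) p t = p (max 0 (2 * t - 1))" for t
    using assms(2) by (cases "2 * t" "1::real" rule: linorder_cases) (auto simp: loop_join_def)
  show "continuous_on {0..1} (\<lambda>t::real. max 0 (2 * t - 1))" by (intro continuous_intros)
qed (use assms in \<open>auto simp: pathin_def\<close>)

lemma path_homotopic_triangle:
  fixes T :: "'b::real_normed_vector \<Rightarrow> 'a"
  assumes "continuous_map (top_of_set S) X T" "convex S" "a \<in> S" "b \<in> S" "c \<in> S"
  shows "path_homotopic X (loop_join (\<lambda>t. T (linepath a b t)) (\<lambda>t. T (linepath b c t)))
           (\<lambda>t. T (linepath a c t))"
proof (rule path_homotopic_via_convex[OF assms(1,2),
      of "linepath a b +++ linepath b c" "linepath a c"])
  show "continuous_on {0..1} (linepath a b +++ linepath b c)"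
    using path_join_imp[OF path_linepath[of a b] path_linepath[of b c]] by (simp add: path_def)
  show "continuous_on {0..1} (linepath a c)"
    using path_linepath[of a c] by (simp only: path_def)
  have "path_image (linepath a c) \<subseteq> S"
    using assms by (simp add: closed_segment_subset)
  then show "linepath a c \<in> {0..1} \<rightarrow> S"
    unfolding path_image_def by blast
  have "path_image (linepath a b +++ linepath b c) \<subseteq> S"
    using assms by (intro subset_path_image_join) (simp_all add: closed_segment_subset)
  then show "linepath a b +++ linepath b c \<in> {0..1} \<rightarrow> S"
    unfolding path_image_def by blast
qed (simp_all add: joinpaths_def loop_join_def linepath_0' linepath_1')

section \<open>Singular cocycles of degree one\<close>

text \<open>Dual to \<open>chain_boundary_boundary_alt\<close>, through evaluation of chains on the
  cochain.\<close>

lemma coboundary_coboundary: "coboundary K (Suc n) (coboundary K n c) = (\<lambda>\<sigma>. 0)"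
proof
  fix \<sigma>
  show "coboundary K (Suc n) (coboundary K n c) \<sigma> = 0"
  proof (cases "singular_simplex (Suc (Suc n)) K \<sigma>")
    case True
    \<comment> \<open>\<open>P\<close> evaluates chains on \<open>c\<close>. Since
      \<open>frag_extend\<close> takes values in a free abelian group, the free group on the single
      generator \<open>()\<close> stands for the integers.\<close>
    define P where "P = frag_extend (\<lambda>\<tau>. frag_cmul (c \<tau>) (frag_of ()))"
    have P_boundary: "P (chain_boundary (Suc n) (frag_of \<tau>)) = frag_cmul (coboundary K n c \<tau>) (frag_of ())"
      if "singular_simplex (Suc n) K \<tau>" for \<tau>
    proof -
      have "P (chain_boundary (Suc n) (frag_of \<tau>))
          = (\<Sum>i\<le>Suc n. frag_cmul ((- 1) ^ i * c (singular_face (Suc n) i \<tau>)) (frag_of ()))"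
        unfolding P_def chain_boundary_of
        by (simp add: frag_extend_sum frag_extend_cmul o_def frag_extend_add del: sum.atMost_Suc)
      also have "\<dots> = frag_cmul (coboundary K n c \<tau>) (frag_of ())"
        by (rule poly_mapping_eqI) (simp add: coboundary_def that lookup_sum del: sum.atMost_Suc)
      finally show ?thesis .
    qed
    have face: "singular_simplex (Suc n) K (singular_face (Suc (Suc n)) i \<sigma>)" if "i \<le> Suc (Suc n)" for i
      using singular_simplex_singular_face[OF True, of i] that by simp
    have "0 = P (chain_boundary (Suc n) (chain_boundary (Suc (Suc n)) (frag_of \<sigma>)))"
      using chain_boundary_boundary_alt[of "Suc n" K "frag_of \<sigma>"] True
      by (simp add: P_def singular_chain_of)
    also have "\<dots> = (\<Sum>i\<le>Suc (Suc n). frag_cmul ((- 1) ^ i)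
        (P (chain_boundary (Suc n) (frag_of (singular_face (Suc (Suc n)) i \<sigma>)))))"
      unfolding P_def chain_boundary_of[of "Suc (Suc n)"] chain_boundary_def[of "Suc n"]
      by (simp add: frag_extend_sum frag_extend_cmul o_def del: sum.atMost_Suc)
    also have "\<dots> = (\<Sum>i\<le>Suc (Suc n). frag_cmul ((- 1) ^ i *
        coboundary K n c (singular_face (Suc (Suc n)) i \<sigma>)) (frag_of ()))"
      by (rule sum.cong) (simp_all add: P_boundary face)
    also have "\<dots> = frag_cmul (coboundary K (Suc n) (coboundary K n c) \<sigma>) (frag_of ())"
      by (rule poly_mapping_eqI)
        (simp add: coboundary_def[of K "Suc n"] True lookup_sum del: sum.atMost_Suc)
    finally show ?thesis by simp
  qed (simp add: coboundary_def)
qed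

lemma coboundary_lincomb:
  "coboundary K n (\<lambda>\<sigma>. r * c \<sigma> + s * d \<sigma>) = (\<lambda>\<sigma>. r * coboundary K n c \<sigma> + s * coboundary K n d \<sigma>)"
proof
  fix \<sigma>
  have "(\<Sum>i\<le>Suc n. (- 1) ^ i * (r * c (f i) + s * d (f i))) =
      r * (\<Sum>i\<le>Suc n. (- 1) ^ i * c (f i)) + s * (\<Sum>i\<le>Suc n. (- 1) ^ i * d (f i))" for f
    unfolding sum_distrib_left sum.distrib[symmetric] by (rule sum.cong) (simp_all add: algebra_simps)
  then show "coboundary K n (\<lambda>\<sigma>. r * c \<sigma> + s * d \<sigma>) \<sigma> = r * coboundary K n c \<sigma> + s * coboundary K n d \<sigma>"
    by (simp add: coboundary_def del: sum.atMost_Suc)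
qed

lemma cochains_lincomb:
  "c \<in> cochains K n \<Longrightarrow> d \<in> cochains K n \<Longrightarrow> (\<lambda>\<sigma>. r * c \<sigma> + s * d \<sigma>) \<in> cochains K n"
  by (simp add: cochains_def)

lemma cocycles_lincomb:
  "c \<in> cocycles K n \<Longrightarrow> d \<in> cocycles K n \<Longrightarrow> (\<lambda>\<sigma>. r * c \<sigma> + s * d \<sigma>) \<in> cocycles K n"
  by (simp add: cocycles_def cochains_lincomb coboundary_lincomb)

lemma coboundaries_lincomb:
  assumes "c \<in> coboundaries K n" "d \<in> coboundaries K n"
  shows "(\<lambda>\<sigma>. r * c \<sigma> + s * d \<sigma>) \<in> coboundaries K n"
proof (cases n)
  case (Suc m)
  then obtain c' d' where "c' \<in> cochains K m" "d' \<in> cochains K m"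
    "c = coboundary K m c'" "d = coboundary K m d'"
    using assms by (auto simp: coboundaries_def)
  then show ?thesis
    using imageI[OF cochains_lincomb[of c' K m d' r s], of "coboundary K m"]
    by (simp add: coboundaries_def Suc coboundary_lincomb)
qed (use assms in \<open>auto simp: coboundaries_def\<close>)

lemma zero_coboundaries: "(\<lambda>\<sigma>. 0) \<in> coboundaries K n"
proof (cases n)
  case (Suc m)
  have "coboundary K m (\<lambda>\<sigma>. 0) = (\<lambda>\<sigma>. 0)" "(\<lambda>\<sigma>. 0) \<in> cochains K m"
    by (simp_all add: coboundary_def cochains_def fun_eq_iff)
  then show ?thesis
    unfolding coboundaries_def using Suc by (metis diff_Suc_1 image_eqI nat.distinct(1))
qed (simp add: coboundaries_def)

section \<open>Two-torsion in a cohomology group of odd order\<close>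

lemma even_card_fixpoint_free_involution:
  assumes "finite A" "\<And>x. x \<in> A \<Longrightarrow> \<phi> x \<in> A" "\<And>x. x \<in> A \<Longrightarrow> \<phi> (\<phi> x) = x"
    "\<And>x. x \<in> A \<Longrightarrow> \<phi> x \<noteq> x"
  shows "even (card A)"
proof -
  define P where "P = (\<lambda>x. {x, \<phi> x}) ` A"
  have "\<Union>P = A" using assms(2) by (auto simp: P_def)
  moreover have "2 * card P = card (\<Union>P)"
  proof (rule card_partition)
    show "card c = 2" if "c \<in> P" for c
      using that assms(4) by (force simp: P_def card_2_iff)
    have "c = {w, \<phi> w}" if "c \<in> P" "w \<in> c" for c w
      using that assms(3) by (auto simp: P_def)
    then show "c \<inter> d = {}" if "c \<in> P" "d \<in> P" "c \<noteq> d" for c d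
      using that by (metis disjoint_iff)
  qed (use assms \<open>\<Union>P = A\<close> in \<open>simp_all add: P_def\<close>)
  ultimately show ?thesis by (metis dvd_triv_left)
qed

text \<open>Translation by the class of \<open>b\<close> permutes the cosets. It is an involution
  because \<open>2 * b\<close> is a coboundary, and it would have no fixed coset if \<open>b\<close>
  were not one; the number of cosets would then be even.\<close>

lemma two_torsion_cocycle_is_coboundary:
  assumes fin: "finite (cohomology_group K n)" and odd: "odd (card (cohomology_group K n))"
    and b: "b \<in> cocycles K n" and bb: "(\<lambda>\<sigma>. 2 * b \<sigma>) \<in> coboundaries K n"
  shows "b \<in> coboundaries K n"
proof (rule ccontr)
  assume nb: "b \<notin> coboundaries K n"
  define cls where "cls c = {d \<in> cocycles K n. (\<lambda>\<sigma>. c \<sigma> - d \<sigma>) \<in> coboundaries K n}" for c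
  define \<phi> where "\<phi> C = (\<lambda>c \<sigma>. c \<sigma> + b \<sigma>) ` C" for C :: "(((nat \<Rightarrow> real) \<Rightarrow> 'a) \<Rightarrow> int) set"
  have H: "cohomology_group K n = cls ` cocycles K n"
    unfolding cohomology_group_def quotient_def cls_def by auto
  have cls_eq: "cls c = cls d" if "(\<lambda>\<sigma>. c \<sigma> - d \<sigma>) \<in> coboundaries K n" for c d
  proof -
    have "(\<lambda>\<sigma>. c \<sigma> - e \<sigma>) \<in> coboundaries K n \<longleftrightarrow> (\<lambda>\<sigma>. d \<sigma> - e \<sigma>) \<in> coboundaries K n" for e
      using coboundaries_lincomb[OF _ that, of "\<lambda>\<sigma>. d \<sigma> - e \<sigma>" 1 1]
        coboundaries_lincomb[OF _ that, of "\<lambda>\<sigma>. c \<sigma> - e \<sigma>" 1 "-1"] by auto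
    then show ?thesis by (simp add: cls_def)
  qed
  have add: "(\<lambda>\<sigma>. c \<sigma> + b \<sigma>) \<in> cocycles K n" "(\<lambda>\<sigma>. c \<sigma> - b \<sigma>) \<in> cocycles K n"
    if "c \<in> cocycles K n" for c
    using cocycles_lincomb[OF that b, of 1 1] cocycles_lincomb[OF that b, of 1 "-1"] by simp_all
  have \<phi>: "\<phi> (cls c) = cls (\<lambda>\<sigma>. c \<sigma> + b \<sigma>)" for c
  proof
    show "\<phi> (cls c) \<subseteq> cls (\<lambda>\<sigma>. c \<sigma> + b \<sigma>)"
      by (auto simp: \<phi>_def cls_def add)
    show "cls (\<lambda>\<sigma>. c \<sigma> + b \<sigma>) \<subseteq> \<phi> (cls c)"
    proof
      fix d assume d: "d \<in> cls (\<lambda>\<sigma>. c \<sigma> + b \<sigma>)"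
      have "(\<lambda>\<sigma>. c \<sigma> - (d \<sigma> - b \<sigma>)) = (\<lambda>\<sigma>. c \<sigma> + b \<sigma> - d \<sigma>)" by auto
      then have "(\<lambda>\<sigma>. d \<sigma> - b \<sigma>) \<in> cls c"
        using d add(2)[of d] by (simp add: cls_def)
      then show "d \<in> \<phi> (cls c)"
        unfolding \<phi>_def by (rule rev_image_eqI) simp
    qed
  qed
  have "even (card (cohomology_group K n))"
  proof (rule even_card_fixpoint_free_involution[OF fin, of \<phi>])
    fix C assume "C \<in> cohomology_group K n"
    then obtain c where c: "c \<in> cocycles K n" "C = cls c" using H by auto
    show "\<phi> C \<in> cohomology_group K n" using c add by (simp add: H \<phi>)
    have "(\<lambda>\<sigma>. c \<sigma> + b \<sigma> + b \<sigma> - c \<sigma>) = (\<lambda>\<sigma>. 2 * b \<sigma>)" by auto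
    then have "cls (\<lambda>\<sigma>. c \<sigma> + b \<sigma> + b \<sigma>) = cls c" using bb by (intro cls_eq) simp
    then show "\<phi> (\<phi> C) = C" by (simp add: c \<phi>)
    have "c \<in> cls c" using c zero_coboundaries by (simp add: cls_def)
    moreover have "c \<notin> cls (\<lambda>\<sigma>. c \<sigma> + b \<sigma>)" using nb by (simp add: cls_def)
    ultimately show "\<phi> C \<noteq> C" by (auto simp: c \<phi>)
  qed
  with odd show False by simp
qed

text \<open>The Bockstein of a mod 2 class is 2-torsion, so it vanishes in a group of odd order.\<close>
lemma integral_lift_of_mod2_cocycle:
  assumes "finite (cohomology_group K (Suc n))" "odd (card (cohomology_group K (Suc n)))"
    and a: "a \<in> cochains K n" and even: "\<And>\<sigma>. even (coboundary K n a \<sigma>)"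
  obtains z where "z \<in> cocycles K n" "\<And>\<sigma>. even (a \<sigma> - z \<sigma>)"
proof -
  define b where "b = (\<lambda>\<sigma>. coboundary K n a \<sigma> div 2)"
  have ab: "coboundary K n a = (\<lambda>\<sigma>. 2 * b \<sigma>)" using even by (simp add: b_def)
  have "b \<in> cochains K (Suc n)" by (simp add: b_def cochains_def coboundary_def)
  moreover have "coboundary K (Suc n) b = (\<lambda>\<sigma>. 0)"
  proof -
    have "(\<lambda>\<sigma>. 2 * coboundary K (Suc n) b \<sigma>) = (\<lambda>\<sigma>. 0)"
      using coboundary_coboundary[of K n a] coboundary_lincomb[of K "Suc n" 2 b 0 b]
      by (simp add: ab)
    then show ?thesis by (simp add: fun_eq_iff)
  qed
  ultimately have "b \<in> cocycles K (Suc n)" by (simp add: cocycles_def)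
  moreover have "(\<lambda>\<sigma>. 2 * b \<sigma>) \<in> coboundaries K (Suc n)"
    using a by (simp add: coboundaries_def flip: ab)
  ultimately have "b \<in> coboundaries K (Suc n)"
    by (rule two_torsion_cocycle_is_coboundary[OF assms(1,2)])
  then obtain c where c: "c \<in> cochains K n" "b = coboundary K n c"
    by (auto simp: coboundaries_def)
  \<comment> \<open>Since \<open>b\<close> is the coboundary of \<open>c\<close>, subtracting
    \<open>2 * c\<close> cancels the coboundary of \<open>a\<close> and preserves parity.\<close>
  define z where "z = (\<lambda>\<sigma>. 1 * a \<sigma> + (-2) * c \<sigma>)"
  have "coboundary K n z = (\<lambda>\<sigma>. 0)"
    unfolding z_def coboundary_lincomb by (simp add: ab c)
  then have "z \<in> cocycles K n"
    using cochains_lincomb[OF a c(1), of 1 "-2"] by (simp add: cocycles_def z_def)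
  then show thesis by (rule that) (simp add: z_def)
qed

section \<open>Paths as singular 1-simplices\<close>

lemma singular_simplex_top_of_set:
  "singular_simplex p K f \<longleftrightarrow>
     continuous_map (top_of_set (standard_simplex p)) K f \<and> f \<in> extensional (standard_simplex p)"
  unfolding singular_simplex_def euclidean_product_topology ..

text \<open>The barycentric coordinate \<open>x 1\<close> is the time. Restriction makes the map
  extensional, as singular simplices must be, so a cochain sees only the values on the unit
  interval.\<close>

definition path_simplex :: "(real \<Rightarrow> 'a) \<Rightarrow> (nat \<Rightarrow> real) \<Rightarrow> 'a" where
  "path_simplex g = restrict (\<lambda>x. g (x 1)) (standard_simplex 1)"

definition simplex_path :: "((nat \<Rightarrow> real) \<Rightarrow> 'a) \<Rightarrow> real \<Rightarrow> 'a" where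
  "simplex_path s t = s (\<lambda>i. if i = 0 then 1 - t else if i = 1 then t else 0)"

lemma continuous_on_coordinate: "continuous_on S (\<lambda>x::nat \<Rightarrow> real. x i)"
  by (rule continuous_on_subset[OF continuous_on_product_coordinates]) simp

lemma continuous_on_if_const:
  "continuous_on S f \<Longrightarrow> continuous_on S g \<Longrightarrow> continuous_on S (\<lambda>x. if b then f x else g x)"
  by (cases b) simp_all

lemma standard_simplex_1:
  "standard_simplex (Suc 0) =
     {x. (\<forall>i. 0 \<le> x i \<and> x i \<le> 1) \<and> (\<forall>i>Suc 0. x i = 0) \<and> x 0 + x (Suc 0) = 1}"
  by (auto simp: standard_simplex_def)

lemma standard_simplex_2:
  "standard_simplex 2 = {x. (\<forall>i. 0 \<le> x i \<and> x i \<le> 1) \<and> (\<forall>i>2. x i = 0) \<and> x 0 + x 1 + x 2 = 1}"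
  by (auto simp: standard_simplex_def numeral_2_eq_2)

lemma singular_simplex_path_simplex:
  assumes "pathin K g"
  shows "singular_simplex 1 K (path_simplex g)"
proof -
  have "continuous_map (top_of_set (standard_simplex 1)) K (\<lambda>x. g (x 1))"
    using assms unfolding pathin_def
    by (rule continuous_map_compose_on) (auto simp: continuous_on_coordinate standard_simplex_1)
  then have "continuous_map (top_of_set (standard_simplex 1)) K (path_simplex g)"
    by (rule continuous_map_eq) (simp add: path_simplex_def)
  then show ?thesis
    by (simp add: singular_simplex_top_of_set path_simplex_def)
qed

lemma path_simplex_cong:
  assumes "\<And>t. t \<in> {0..1} \<Longrightarrow> g t = h t"
  shows "path_simplex g = path_simplex h"
  unfolding path_simplex_def by (rule restrict_ext) (auto simp: standard_simplex_1 intro: assms)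

lemma pathin_simplex_path:
  assumes "singular_simplex 1 K s"
  shows "pathin K (simplex_path s)"
  unfolding pathin_def simplex_path_def
proof (rule continuous_map_compose_on[of "standard_simplex 1" K s])
  show "continuous_map (top_of_set (standard_simplex 1)) K s"
    using assms by (simp add: singular_simplex_top_of_set)
  show "continuous_on {0..1} (\<lambda>t::real. \<lambda>i::nat. if i = 0 then 1 - t else if i = 1 then t else 0)"
    by (intro continuous_on_coordinatewise_then_product)
      (intro continuous_on_if_const continuous_intros)
qed (auto simp: standard_simplex_1)

lemma simplex_path_path_simplex: "t \<in> {0..1} \<Longrightarrow> simplex_path (path_simplex g) t = g t"
  by (auto simp: simplex_path_def path_simplex_def standard_simplex_1)

text \<open>Face \<open>i\<close> is opposite vertex \<open>i\<close>, so the three terms belong to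
  the edges 12, 02 and 01.\<close>

lemma coboundary_1:
  assumes "singular_simplex 2 K s"
  shows "coboundary K 1 c s = c (singular_face 2 0 s) - c (singular_face 2 1 s) + c (singular_face 2 2 s)"
  using assms by (simp add: coboundary_def numeral_2_eq_2)

text \<open>The affine map of the standard 2-simplex onto the triangle \<open>a\<close>,
  \<open>b\<close>, \<open>c\<close>, degenerate or not, followed by \<open>T\<close> is a singular
  simplex with these three edges. The cocycle condition enters all later path computations through
  this lemma.\<close>

lemma cocycle_triangle:
  fixes T :: "'b::real_normed_vector \<Rightarrow> 'a"
  assumes z: "z \<in> cocycles K 1" and T: "continuous_map (top_of_set S) K T"
    and S: "convex S" "a \<in> S" "b \<in> S" "c \<in> S"
  shows "z (path_simplex (\<lambda>t. T (linepath a b t))) + z (path_simplex (\<lambda>t. T (linepath b c t)))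
       = z (path_simplex (\<lambda>t. T (linepath a c t)))"
proof -
  define u where "u x = x 0 *\<^sub>R a + x 1 *\<^sub>R b + x 2 *\<^sub>R c" for x :: "nat \<Rightarrow> real"
  define s where "s = restrict (\<lambda>x. T (u x)) (standard_simplex 2)"
  have "continuous_map (top_of_set (standard_simplex 2)) K (\<lambda>x. T (u x))"
  proof (rule continuous_map_compose_on[OF T])
    show "continuous_on (standard_simplex 2) u"
      unfolding u_def by (intro continuous_intros continuous_on_coordinate)
    show "u \<in> standard_simplex 2 \<rightarrow> S"
    proof
      fix x assume "x \<in> standard_simplex 2"
      then have "x 0 *\<^sub>R a + x 1 *\<^sub>R b + x 2 *\<^sub>R c \<in> convex hull {a, b, c}"
        by (auto simp: convex_hull_3 standard_simplex_2)
      then show "u x \<in> S"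
        using S hull_minimal[of "{a, b, c}" S convex] by (auto simp: u_def)
    qed
  qed
  then have "continuous_map (top_of_set (standard_simplex 2)) K s"
    by (rule continuous_map_eq) (simp add: s_def)
  then have s: "singular_simplex 2 K s"
    by (simp add: singular_simplex_top_of_set s_def)
  have face: "singular_face 2 k s = path_simplex g"
    if "k \<le> 2" "\<And>x. x \<in> standard_simplex 1 \<Longrightarrow> g (x 1) = T (u (simplical_face k x))" for k g
    unfolding singular_face_def path_simplex_def
  proof (simp, rule restrict_ext)
    fix x :: "nat \<Rightarrow> real" assume x: "x \<in> standard_simplex (Suc 0)"
    then have "simplical_face k x \<in> standard_simplex 2"
      using simplical_face_in_standard_simplex[of 2 k x] that by simp
    then show "(s \<circ> simplical_face k) x = g (x (Suc 0))"
      using that(2)[of x] x by (simp add: s_def)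
  qed
  have x0: "x 0 = 1 - x 1" if "x \<in> standard_simplex 1" for x
    using that by (simp add: standard_simplex_1)
  have "singular_face 2 0 s = path_simplex (\<lambda>t. T (linepath b c t))"
    "singular_face 2 1 s = path_simplex (\<lambda>t. T (linepath a c t))"
    "singular_face 2 2 s = path_simplex (\<lambda>t. T (linepath a b t))"
    by (rule face; simp add: u_def simplical_face_def linepath_def x0)+
  moreover have "coboundary K 1 z s = 0" using z by (simp add: cocycles_def)
  ultimately show ?thesis using coboundary_1[OF s, of z] by simp
qed

lemma path_homotopic_cong:
  assumes "\<And>t. t \<in> {0..1} \<Longrightarrow> p t = p' t" "\<And>t. t \<in> {0..1} \<Longrightarrow> q t = q' t"
  shows "path_homotopic X p q \<longleftrightarrow> path_homotopic X p' q'"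
  using assms by (simp add: path_homotopic_def)

lemma path_homotopic_simplex_faces:
  assumes s: "singular_simplex 2 K s"
  shows "path_homotopic K
    (loop_join (simplex_path (singular_face 2 2 s)) (simplex_path (singular_face 2 0 s)))
    (simplex_path (singular_face 2 1 s))"
    and "simplex_path (singular_face 2 2 s) 1 = simplex_path (singular_face 2 0 s) 0"
    and "simplex_path (singular_face 2 1 s) 0 = simplex_path (singular_face 2 2 s) 0"
    and "simplex_path (singular_face 2 1 s) 1 = simplex_path (singular_face 2 0 s) 1"
proof -
  \<comment> \<open>The simplex is parametrised by a plane triangle through its barycentric
    coordinates 1 and 2, because \<open>path_homotopic_triangle\<close> works over a convex subset
    of a normed space.\<close>
  define u where "u z = (\<lambda>i::nat. if i = 0 then 1 - fst z - snd z else if i = 1 then fst z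
      else if i = 2 then snd z else 0)" for z :: "real \<times> real"
  define S where "S = {z :: real \<times> real. 0 \<le> fst z \<and> 0 \<le> snd z \<and> fst z + snd z \<le> 1}"
  have T: "continuous_map (top_of_set S) K (\<lambda>z. s (u z))"
  proof (rule continuous_map_compose_on[of "standard_simplex 2" K s])
    show "continuous_map (top_of_set (standard_simplex 2)) K s"
      using s by (simp add: singular_simplex_top_of_set)
    show "continuous_on S u"
      unfolding u_def
      by (intro continuous_on_coordinatewise_then_product)
        (intro continuous_on_if_const continuous_intros)
  qed (auto simp: S_def u_def standard_simplex_2)
  have "convex S"
  proof -
    have "S = {z. (1, 0) \<bullet> z \<ge> 0} \<inter> {z. (0, 1) \<bullet> z \<ge> 0} \<inter> {z. (1, 1) \<bullet> z \<le> 1}"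
      by (auto simp: S_def)
    then show ?thesis
      by (simp add: convex_Int convex_halfspace_ge convex_halfspace_le)
  qed
  have face: "simplex_path (singular_face 2 k s) t
      = s (simplical_face k (\<lambda>i. if i = 0 then 1 - t else if i = 1 then t else 0))"
    if "t \<in> {0..1}" for k t
    using that by (auto simp: simplex_path_def singular_face_def standard_simplex_def)
  have edges: "simplex_path (singular_face 2 2 s) t = s (u (linepath (0, 0) (1, 0) t))"
    "simplex_path (singular_face 2 0 s) t = s (u (linepath (1, 0) (0, 1) t))"
    "simplex_path (singular_face 2 1 s) t = s (u (linepath (0, 0) (0, 1) t))"
    if "t \<in> {0..1}" for t
    unfolding face[OF that]
    by (rule arg_cong[of _ _ s], force simp: linepath_def simplical_face_def u_def)+
  have "path_homotopic K (loop_join (\<lambda>t. s (u (linepath (0, 0) (1, 0) t)))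
      (\<lambda>t. s (u (linepath (1, 0) (0, 1) t)))) (\<lambda>t. s (u (linepath (0, 0) (0, 1) t)))"
    by (rule path_homotopic_triangle[OF T \<open>convex S\<close>]) (auto simp: S_def)
  then show "path_homotopic K
    (loop_join (simplex_path (singular_face 2 2 s)) (simplex_path (singular_face 2 0 s)))
    (simplex_path (singular_face 2 1 s))"
    by (rule iffD1[OF path_homotopic_cong, rotated 2]) (auto simp: loop_join_def edges simp del: One_nat_def)
  show "simplex_path (singular_face 2 2 s) 1 = simplex_path (singular_face 2 0 s) 0"
    "simplex_path (singular_face 2 1 s) 0 = simplex_path (singular_face 2 2 s) 0"
    "simplex_path (singular_face 2 1 s) 1 = simplex_path (singular_face 2 0 s) 1"
    by (simp_all add: edges linepath_0' linepath_1' del: One_nat_def)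
qed

section \<open>Integral lifts of homomorphisms to the group of order two\<close>

locale pi1_hom_to_Z2 =
  fixes K :: "'a topology" and x0 :: 'a and \<alpha> :: "(real \<Rightarrow> 'a) \<Rightarrow> bool" and P :: "'a \<Rightarrow> real \<Rightarrow> 'a"
  assumes hom: "pi1_hom_Z2 K x0 \<alpha>"
    and P: "\<And>x. x \<in> topspace K \<Longrightarrow> pathin K (P x) \<and> P x 0 = x0 \<and> P x 1 = x"
begin

text \<open>Closing up with the chosen paths extends \<open>\<alpha>\<close> to all singular
  1-simplices. \<open>P x0\<close> may be any loop; conjugation by it has no effect on values in an
  abelian group.\<close>

definition based_loop :: "(real \<Rightarrow> 'a) \<Rightarrow> real \<Rightarrow> 'a" where
  "based_loop g = loop_join (P (g 0)) (loop_join g (\<lambda>t. P (g 1) (1 - t)))"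

lemma hom_join: "loopin K x0 p \<Longrightarrow> loopin K x0 q \<Longrightarrow> \<alpha> (loop_join p q) = (\<alpha> p \<noteq> \<alpha> q)"
  using hom by (simp add: pi1_hom_Z2_def)

lemma hom_homotopic:
  assumes "path_homotopic K p q" "loopin K x0 p" "loopin K x0 q"
  shows "\<alpha> p = \<alpha> q"
proof -
  have "homotopic_loops_rel K x0 p q"
    using assms by (intro path_homotopic_imp_homotopic_loops_rel) (auto simp: loopin_def)
  then show ?thesis using hom assms by (simp add: pi1_hom_Z2_def)
qed

lemma pathin_ends: "pathin K g \<Longrightarrow> g 0 \<in> topspace K" "pathin K g \<Longrightarrow> g 1 \<in> topspace K"
  by (auto simp: pathin_def continuous_map_def Pi_iff)

text \<open>This is the mod 2 cocycle condition. In the product of the two based loops, the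
  connecting path to the common point and its reverse meet in the middle; rebracketing brings them
  together and they cancel.\<close>

lemma based_loop_join:
  assumes g: "pathin K g" and h: "pathin K h" and k: "pathin K k"
    and gh: "g 1 = h 0" and k0: "k 0 = g 0" and k1: "k 1 = h 1"
    and hk: "path_homotopic K (loop_join g h) k"
  shows "\<alpha> (based_loop k) = (\<alpha> (based_loop g) \<noteq> \<alpha> (based_loop h))"
proof -
  define p q r where "p = P (g 0)" and "q = P (h 0)" and "r = P (h 1)"
  define q' r' where "q' = (\<lambda>t. q (1 - t))" and "r' = (\<lambda>t. r (1 - t))"
  have p: "pathin K p" "p 0 = x0" "p 1 = g 0"
    and q: "pathin K q" "q 0 = x0" "q 1 = h 0"
    and r: "pathin K r" "r 0 = x0" "r 1 = h 1"
    using P pathin_ends g h by (auto simp: p_def q_def r_def)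
  have q': "pathin K q'" "q' 0 = h 0" "q' 1 = x0" and r': "pathin K r'" "r' 0 = h 1" "r' 1 = x0"
    using q r pathin_reverse by (auto simp: q'_def r'_def)
  note ends = p q r q' r' gh k0 k1
  note J = pathin_loop_join[where X = K] path_homotopic_refl[where X = K]
    path_homotopic_join[where X = K]
  have L: "loopin K x0 l" if "pathin K l" "l 0 = x0" "l 1 = x0" for l
    using that by (simp add: loopin_def)
  have eqs: "based_loop g = loop_join p (loop_join g q')" "based_loop h = loop_join q (loop_join h r')"
    "based_loop k = loop_join p (loop_join k r')"
    by (simp_all add: based_loop_def p_def q'_def q_def r'_def r_def gh k0 k1)
  have qq: "path_homotopic K (loop_join q' q) (\<lambda>t. h 0)"
    using path_homotopic_reverse_join[OF q(1)] by (simp add: q'_def q)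
  let ?hr = "loop_join h r'"
  have "(\<alpha> (based_loop g) \<noteq> \<alpha> (based_loop h)) = \<alpha> (loop_join (loop_join p (loop_join g q')) (loop_join q ?hr))"
    unfolding eqs by (rule hom_join[symmetric]; rule L; simp add: J ends g h k)
  also have "\<dots> = \<alpha> (loop_join p (loop_join (loop_join g q') (loop_join q ?hr)))"
    by (rule hom_homotopic; (rule path_homotopic_assoc | rule L)?; simp add: J ends g h k)
  also have "\<dots> = \<alpha> (loop_join p (loop_join g (loop_join q' (loop_join q ?hr))))"
    by (rule hom_homotopic; (rule path_homotopic_join path_homotopic_assoc path_homotopic_refl | rule L)?;
        simp add: J ends g h k path_homotopic_assoc)
  also have "\<dots> = \<alpha> (loop_join p (loop_join g (loop_join (loop_join q' q) ?hr)))"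
    by (rule hom_homotopic[symmetric]; (rule path_homotopic_join path_homotopic_assoc path_homotopic_refl | rule L)?;
        simp add: J ends g h k path_homotopic_assoc)
  also have "\<dots> = \<alpha> (loop_join p (loop_join g (loop_join (\<lambda>t. h 0) ?hr)))"
    by (rule hom_homotopic; (rule path_homotopic_join path_homotopic_refl | rule L)?;
        simp add: J ends g h k qq pathin_ends)
  also have "\<dots> = \<alpha> (loop_join p (loop_join g ?hr))"
    by (rule hom_homotopic; (rule path_homotopic_join path_homotopic_refl | rule L)?;
        simp add: J ends g h k path_homotopic_const_join pathin_ends)
  also have "\<dots> = \<alpha> (loop_join p (loop_join (loop_join g h) r'))"
    by (rule hom_homotopic[symmetric]; (rule path_homotopic_join path_homotopic_assoc path_homotopic_refl | rule L)?;
        simp add: J ends g h k path_homotopic_assoc)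
  also have "\<dots> = \<alpha> (loop_join p (loop_join k r'))"
    by (rule hom_homotopic; (rule path_homotopic_join path_homotopic_refl | rule L)?;
        simp add: J ends g h k hk)
  finally show ?thesis by (simp add: eqs)
qed

lemma based_loop_of_loop:
  assumes "loopin K x0 g"
  shows "\<alpha> (based_loop g) = \<alpha> g"
proof -
  have x0: "x0 \<in> topspace K" using assms pathin_ends by (auto simp: loopin_def)
  define p p' where "p = P x0" and "p' = (\<lambda>t. p (1 - t))"
  have p: "loopin K x0 p" using P[OF x0] by (simp add: loopin_def p_def)
  then have p': "loopin K x0 p'" using pathin_reverse by (auto simp: loopin_def p'_def)
  have c: "loopin K x0 (\<lambda>t. x0)" using x0 by (simp add: loopin_def)
  have join: "loopin K x0 (loop_join a b)" if "loopin K x0 a" "loopin K x0 b" for a b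
    using that pathin_loop_join[of K a b] by (simp add: loopin_def)
  have "path_homotopic K (loop_join p p') (\<lambda>t. x0)"
    using path_homotopic_join_reverse[of K p] p by (simp add: loopin_def p'_def)
  then have "(\<alpha> p \<noteq> \<alpha> p') = \<alpha> (\<lambda>t. x0)"
    using hom_homotopic[of "loop_join p p'" "\<lambda>t. x0"] join p p' c hom_join by simp
  \<comment> \<open>The constant loop equals its own join with itself, so its value is a sum of two
    equal elements of the group of order two, that is \<open>False\<close>.\<close>
  moreover have "loop_join (\<lambda>t. x0) (\<lambda>t. x0) = (\<lambda>t. x0)" by (simp add: loop_join_def)
  then have "\<not> \<alpha> (\<lambda>t. x0)" using hom_join[OF c c] by simp
  moreover have "based_loop g = loop_join p (loop_join g p')"
    using assms by (simp add: based_loop_def loopin_def p_def p'_def)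
  ultimately show ?thesis
    using hom_join assms p p' join by auto
qed

lemma integral_lift:
  assumes "finite (cohomology_group K 2)" "odd (card (cohomology_group K 2))"
  obtains z where "z \<in> cocycles K 1" "\<And>\<gamma>. loopin K x0 \<gamma> \<Longrightarrow> \<alpha> \<gamma> \<longleftrightarrow> odd (z (path_simplex \<gamma>))"
proof -
  define a where "a s = (if singular_simplex 1 K s \<and> \<alpha> (based_loop (simplex_path s)) then 1 else 0 :: int)"
    for s
  have "even (coboundary K 1 a s)" for s
  proof (cases "singular_simplex 2 K s")
    case True
    have face: "singular_simplex 1 K (singular_face 2 i s)" if "i \<le> 2" for i
      using singular_simplex_singular_face[OF True _ that] by simp
    have "\<alpha> (based_loop (simplex_path (singular_face 2 1 s))) =
        (\<alpha> (based_loop (simplex_path (singular_face 2 2 s))) \<noteq> \<alpha> (based_loop (simplex_path (singular_face 2 0 s))))"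
      by (intro based_loop_join path_homotopic_simplex_faces[OF True] pathin_simplex_path face) auto
    then show ?thesis
      unfolding coboundary_1[OF True] a_def using face[of 0] face[of 1] face[of 2] by auto
  qed (simp add: coboundary_def numeral_2_eq_2)
  moreover have "a \<in> cochains K 1" by (simp add: cochains_def a_def)
  ultimately obtain z where z: "z \<in> cocycles K 1" "\<And>s. even (a s - z s)"
    using integral_lift_of_mod2_cocycle[of K 1 a] assms by (auto simp: numeral_2_eq_2)
  have "\<alpha> \<gamma> \<longleftrightarrow> odd (z (path_simplex \<gamma>))" if \<gamma>: "loopin K x0 \<gamma>" for \<gamma>
  proof -
    \<comment> \<open>\<open>g\<close> and \<open>\<gamma>\<close> agree only on the unit interval,
      while \<open>\<alpha>\<close> takes functions on all reals; homotopy invariance identifies the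
      two values.\<close>
    define g where "g = simplex_path (path_simplex \<gamma>)"
    have g: "g t = \<gamma> t" if "t \<in> {0..1}" for t
      using that simplex_path_path_simplex by (simp add: g_def)
    have s: "singular_simplex 1 K (path_simplex \<gamma>)"
      using \<gamma> singular_simplex_path_simplex by (auto simp: loopin_def)
    have lg: "loopin K x0 g"
      using \<gamma> g[of 0] g[of 1] pathin_simplex_path[OF s] by (simp add: loopin_def g_def)
    have "path_homotopic K g \<gamma> \<longleftrightarrow> path_homotopic K \<gamma> \<gamma>"
      by (rule path_homotopic_cong) (simp_all add: g)
    then have "\<alpha> g = \<alpha> \<gamma>"
      using hom_homotopic[OF _ lg \<gamma>] path_homotopic_refl \<gamma> by (auto simp: loopin_def)
    then have "\<alpha> \<gamma> \<longleftrightarrow> odd (a (path_simplex \<gamma>))"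
      using based_loop_of_loop[OF lg] s by (simp add: a_def g_def)
    then show ?thesis using z(2)[of "path_simplex \<gamma>"] by auto
  qed
  with z show thesis by (blast intro: that)
qed

end

section \<open>The projective plane and its projective line\<close>

lemma openin_RP2:
  "openin RP2 U \<longleftrightarrow> U \<subseteq> RP2_points \<and> openin (top_of_set (sphere (0::real^3) 1)) (\<Union>U)"
  unfolding RP2_def by (simp add: topology_inverse'[OF istopology_RP2])

lemma RP2_points_memD: "Q \<in> RP2_points \<Longrightarrow> v \<in> Q \<Longrightarrow> Q = {v, - v} \<and> v \<in> sphere 0 1"
  by (auto simp: RP2_points_def)

lemma RP2_pointsI: "v \<in> sphere 0 1 \<Longrightarrow> {v, - v} \<in> RP2_points"
  unfolding RP2_points_def by blast

lemma Union_RP2_points: "\<Union>RP2_points = sphere 0 1"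
proof
  show "sphere 0 1 \<subseteq> \<Union>RP2_points"
    unfolding RP2_points_def by blast
qed (auto simp: RP2_points_def)

lemma topspace_RP2: "topspace RP2 = RP2_points"
proof
  show "topspace RP2 \<subseteq> RP2_points"
    using openin_RP2[of "topspace RP2"] by simp
  have "openin RP2 RP2_points" by (simp add: openin_RP2 Union_RP2_points)
  then show "RP2_points \<subseteq> topspace RP2" by (rule openin_subset)
qed

lemma continuous_map_antipodal_class:
  "continuous_map (top_of_set (sphere (0::real^3) 1)) RP2 (\<lambda>v. {v, - v})"
  unfolding continuous_map topspace_RP2
proof (intro conjI allI impI)
  show "(\<lambda>v. {v, - v}) ` topspace (top_of_set (sphere (0::real^3) 1)) \<subseteq> RP2_points"
    by (auto simp: RP2_points_def)
  fix U assume U: "openin RP2 U"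
  have "{v \<in> topspace (top_of_set (sphere 0 1)). {v, - v} \<in> U} = \<Union>U"
  proof (intro equalityI subsetI)
    fix v assume "v \<in> \<Union>U"
    then obtain Q where "Q \<in> U" "v \<in> Q" by auto
    moreover from this have "Q \<in> RP2_points" using U by (auto simp: openin_RP2)
    ultimately show "v \<in> {v \<in> topspace (top_of_set (sphere 0 1)). {v, - v} \<in> U}"
      using RP2_points_memD[of Q v] by simp
  qed auto
  then show "openin (top_of_set (sphere 0 1)) {v \<in> topspace (top_of_set (sphere 0 1)). {v, - v} \<in> U}"
    using U by (simp add: openin_RP2)
qed

section \<open>A matrix model of the double covering\<close>

definition outer_square :: "real^3 \<Rightarrow> real^3^3" where
  "outer_square v = (\<chi> i j. v $ i * v $ j)"

lemma outer_square_mult: "outer_square v *v w = (v \<bullet> w) *\<^sub>R v"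
  by (simp add: outer_square_def matrix_vector_mult_def vec_eq_iff inner_vec_def sum_distrib_left
      sum_distrib_right mult_ac)

lemma outer_square_minus [simp]: "outer_square (- v) = outer_square v"
  by (simp add: outer_square_def)

lemma continuous_on_outer_square: "continuous_on S outer_square"
  unfolding outer_square_def by (intro continuous_intros)

lemma continuous_on_matrix_vector_mult: "continuous_on S (\<lambda>M::real^3^3. M *v w)"
  unfolding matrix_vector_mult_def by (intro continuous_intros)

text \<open>The map from the sphere onto its image under \<open>v \<mapsto> v v\<^sup>T\<close> models the covering of the
  projective plane inside a normed space.\<close>
lemma covering_space_outer_square:
  "covering_space (sphere 0 1) outer_square (outer_square ` sphere 0 1)"
proof (rule covering_spaceI)
  fix M assume "M \<in> outer_square ` sphere 0 1"
  then obtain w where w: "w \<in> sphere 0 1" "M = outer_square w" by auto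
  \<comment> \<open>For \<open>N = outer_square v\<close> the quantity
    \<open>w \<bullet> (N *v w)\<close> is the square of \<open>v \<bullet> w\<close>. So
    \<open>T\<close> consists of the lines not orthogonal to \<open>w\<close>, and its two sheets
    are the open hemispheres around \<open>w\<close> and \<open>- w\<close>.\<close>
  define T where "T = {N \<in> outer_square ` sphere 0 1. 0 < w \<bullet> (N *v w)}"
  define sheet where "sheet e = {v \<in> sphere 0 1. 0 < e * (v \<bullet> w)}" for e
  have T_iff: "outer_square v \<in> T \<longleftrightarrow> v \<bullet> w \<noteq> 0" if "v \<in> sphere 0 1" for v
    using that by (auto simp: T_def outer_square_mult inner_commute zero_less_mult_iff linorder_neq_iff)
  have "M \<in> T" using w T_iff[of w] by (auto simp: dot_square_norm)
  moreover have "openin (top_of_set (outer_square ` sphere 0 1)) T"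
  proof -
    have "open {N. 0 < w \<bullet> (N *v w)}"
      by (intro open_Collect_less continuous_intros continuous_on_matrix_vector_mult)
    then show ?thesis
      unfolding T_def by (simp add: openin_open_Int Collect_conj_eq)
  qed
  moreover have "\<Union>{sheet 1, sheet (-1)} = sphere 0 1 \<inter> outer_square -` T"
    using T_iff by (auto simp: sheet_def)
  moreover have "openin (top_of_set (sphere 0 1)) (sheet e)" for e
  proof -
    have "open {v. 0 < e * (v \<bullet> w)}"
      by (intro open_Collect_less continuous_intros)
    moreover have "sheet e = sphere 0 1 \<inter> {v. 0 < e * (v \<bullet> w)}" by (auto simp: sheet_def)
    ultimately show ?thesis by (simp add: openin_open_Int)
  qed
  moreover have "pairwise disjnt {sheet 1, sheet (-1)}"
    by (auto simp: pairwise_def disjnt_def sheet_def)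
  moreover have "\<exists>q. homeomorphism (sheet e) T outer_square q" if e: "e = 1 \<or> e = -1" for e
  proof (intro exI homeomorphismI)
    \<comment> \<open>With \<open>N = outer_square v\<close>, \<open>N *v w\<close> is
      \<open>v\<close> scaled by \<open>v \<bullet> w\<close>, and the square root is the absolute
      value of that factor; the sign \<open>e\<close> of the sheet restores
      \<open>v\<close>.\<close>
    let ?q = "\<lambda>N. (e / sqrt (w \<bullet> (N *v w))) *\<^sub>R (N *v w)"
    have q: "?q (outer_square v) = v" if "v \<in> sheet e" for v
    proof -
      have "sqrt (w \<bullet> ((v \<bullet> w) *\<^sub>R v)) = \<bar>v \<bullet> w\<bar>"
        by (simp add: inner_commute real_sqrt_mult_self flip: power2_eq_square)
      also have "\<dots> = e * (v \<bullet> w)" using that e by (auto simp: sheet_def)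
      finally show ?thesis
        using that e by (auto simp: outer_square_mult sheet_def)
    qed
    show "continuous_on (sheet e) outer_square" by (rule continuous_on_outer_square)
    show "continuous_on T ?q"
      by (intro continuous_intros continuous_on_matrix_vector_mult) (auto simp: T_def)
    show "outer_square ` sheet e \<subseteq> T"
      using T_iff by (auto simp: sheet_def)
    have pre: "\<exists>v \<in> sheet e. N = outer_square v" if N: "N \<in> T" for N
    proof -
      obtain v where v: "v \<in> sphere 0 1" "N = outer_square v" using N by (auto simp: T_def)
      then have "v \<in> sheet e \<or> - v \<in> sheet e"
        using N T_iff[of v] e by (auto simp: sheet_def)
      with v show ?thesis by (metis outer_square_minus)
    qed
    show "?q ` T \<subseteq> sheet e" using pre q by force
    show "?q (outer_square v) = v" if "v \<in> sheet e" for v using q that .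
    show "outer_square (?q N) = N" if "N \<in> T" for N using pre[OF that] q by force
  qed
  ultimately show "\<exists>T. M \<in> T \<and> openin (top_of_set (outer_square ` sphere 0 1)) T \<and>
      (\<exists>v. \<Union>v = sphere 0 1 \<inter> outer_square -` T \<and> (\<forall>u\<in>v. openin (top_of_set (sphere 0 1)) u) \<and>
        pairwise disjnt v \<and> (\<forall>u\<in>v. \<exists>q. homeomorphism u T outer_square q))"
    by (intro exI[of _ T] conjI exI[of _ "{sheet 1, sheet (-1)}"]) auto
qed (auto simp: continuous_on_outer_square)

definition RP2_matrix :: "(real^3) set \<Rightarrow> real^3^3" where
  "RP2_matrix Q = outer_square (SOME v. v \<in> Q)"

lemma RP2_matrix_class: "RP2_matrix {v, - v} = outer_square v"
proof -
  have "(SOME w. w \<in> {v, - v}) \<in> {v, - v}" by (rule someI[of _ v]) simp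
  then show ?thesis unfolding RP2_matrix_def by auto
qed

lemma continuous_map_RP2_matrix: "continuous_map RP2 euclidean RP2_matrix"
  unfolding continuous_map topspace_RP2
proof (intro conjI allI impI)
  fix W :: "(real^3^3) set" assume "openin euclidean W"
  then have "openin (top_of_set (sphere 0 1)) (sphere 0 1 \<inter> outer_square -` W)"
    by (intro continuous_openin_preimage_gen continuous_on_outer_square) auto
  moreover have "\<Union>{Q \<in> RP2_points. RP2_matrix Q \<in> W} = sphere 0 1 \<inter> outer_square -` W"
  proof (intro equalityI subsetI)
    fix v assume "v \<in> \<Union>{Q \<in> RP2_points. RP2_matrix Q \<in> W}"
    then obtain Q where "Q \<in> RP2_points" "v \<in> Q" "RP2_matrix Q \<in> W" by auto
    then show "v \<in> sphere 0 1 \<inter> outer_square -` W"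
      using RP2_points_memD[of Q v] by (simp add: RP2_matrix_class)
  next
    fix v assume "v \<in> sphere 0 1 \<inter> outer_square -` W"
    then have "{v, - v} \<in> {Q \<in> RP2_points. RP2_matrix Q \<in> W}"
      by (simp add: RP2_matrix_class RP2_pointsI)
    then show "v \<in> \<Union>{Q \<in> RP2_points. RP2_matrix Q \<in> W}" by blast
  qed
  ultimately show "openin RP2 {Q \<in> RP2_points. RP2_matrix Q \<in> W}"
    by (simp add: openin_RP2)
qed simp

definition half_turns :: "real \<Rightarrow> real^3" where
  "half_turns y = vector [cos (pi * y), sin (pi * y), 0]"

lemma half_turns_nth: "half_turns y $ 1 = cos (pi * y)" "half_turns y $ 2 = sin (pi * y)"
  "half_turns y $ 3 = 0"
  by (simp_all add: half_turns_def)

lemma half_turns_sphere: "half_turns y \<in> sphere 0 1"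
  by (simp add: norm_eq_sqrt_inner inner_vec_def sum_3 half_turns_nth flip: power2_eq_square)

lemma continuous_on_half_turns: "continuous_on S half_turns"
proof -
  have eq: "half_turns = (\<lambda>y. \<chi> i. if i = 1 then cos (pi * y) else if i = 2 then sin (pi * y) else 0)"
    by (simp add: fun_eq_iff vec_eq_iff forall_3 half_turns_nth)
  have "continuous_on S (\<lambda>y. if i = 1 then cos (pi * y) else if i = 2 then sin (pi * y) else 0)"
    for i :: 3
    by (cases "i = 1"; cases "i = 2") (auto intro!: continuous_intros)
  then show ?thesis unfolding eq by (rule continuous_on_vec_lambda)
qed

lemma half_turns_shift: "half_turns (y + of_int k) = (if even k then half_turns y else - half_turns y)"
proof -
  have "cos (pi * (y + of_int k)) = cos (pi * y) * cos (pi * of_int k)"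
    "sin (pi * (y + of_int k)) = sin (pi * y) * cos (pi * of_int k)"
    by (simp_all add: distrib_left cos_add sin_add)
  then show ?thesis
    by (simp add: vec_eq_iff forall_3 half_turns_nth)
qed

text \<open>A covering of a projective line by the reals. \<open>half_turns\<close> is scaled so
  that a shift by an integer acts as a power of the antipodal map, which gives this function period
  1.\<close>

definition RP1_class :: "real \<Rightarrow> (real^3) set" where
  "RP1_class y = {half_turns y, - half_turns y}"

lemma RP1_class_shift: "RP1_class (y + of_int k) = RP1_class y"
  by (auto simp: RP1_class_def half_turns_shift)

lemma continuous_map_RP1_class: "continuous_map euclidean RP2 RP1_class"
proof -
  have "continuous_map (top_of_set UNIV) RP2 (\<lambda>y. {half_turns y, - half_turns y})"
    using half_turns_sphere
    by (intro continuous_map_compose_on[OF continuous_map_antipodal_class] continuous_on_half_turns) blast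
  then show ?thesis by (simp add: RP1_class_def[abs_def])
qed

text \<open>The line perpendicular to the plane of the great circle is missed.\<close>

lemma RP1_class_not_surj: "range RP1_class \<subset> topspace RP2"
proof -
  have "RP1_class y \<in> RP2_points" for y
    using half_turns_sphere by (auto simp: RP1_class_def RP2_points_def)
  moreover have "{axis 3 1, - axis 3 1} \<noteq> RP1_class y" for y
    by (auto simp: RP1_class_def doubleton_eq_iff vec_eq_iff forall_3 half_turns_nth axis_def)
  moreover have "{axis 3 1, - axis 3 1 :: real^3} \<in> RP2_points"
    unfolding RP2_points_def by (auto intro!: exI[of _ "axis 3 1 :: real^3"])
  ultimately show ?thesis
    unfolding topspace_RP2 by blast
qed

text \<open>\<open>half_turns\<close> composed with \<open>c\<close> lifts \<open>l\<close> to the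
  sphere and ends at its start or at the antipode, according to the parity of \<open>k\<close>. A
  closed lift contracts in the simply connected sphere, and the contraction projects. Conversely, a
  null-homotopy of \<open>l\<close> moves to the matrix model, where monodromy forces the lift to be
  closed; for odd \<open>k\<close> a unit vector would equal its negative.\<close>

lemma RP1_loop_nullhomotopic_iff:
  assumes c: "continuous_on {0..1} c" and l: "\<And>t. t \<in> {0..1} \<Longrightarrow> l t = RP1_class (c t)"
    and k: "c 1 = c 0 + of_int k" and q: "q = l 0"
  shows "homotopic_loops_rel RP2 q l (\<lambda>t. q) \<longleftrightarrow> even k"
proof
  define h where "h = (\<lambda>t. half_turns (c t))"
  have h: "path h" "path_image h \<subseteq> sphere 0 1"
    using half_turns_sphere
    by (auto simp: path_def path_image_def h_def
        intro: continuous_on_compose2[OF continuous_on_half_turns[of UNIV] c])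
  have lh: "l t = {h t, - h t}" if "t \<in> {0..1}" for t
    using that by (simp add: l RP1_class_def h_def)
  have q': "q = {h 0, - h 0}" "l 1 = q"
    using q l[of 0] l[of 1] k RP1_class_shift by (simp_all add: RP1_class_def h_def)
  {
    assume "even k"
    then have "pathfinish h = pathstart h"
      using k by (simp add: pathfinish_def pathstart_def h_def half_turns_shift)
    then have "homotopic_paths (sphere 0 1) h (linepath (h 0) (h 0))"
      using h simply_connected_sphere[of "0::real^3" 1]
      by (simp add: simply_connected_eq_contractible_path pathstart_def)
    then obtain H where H: "continuous_on ({0..1::real} \<times> {0..1::real}) H"
      "H \<in> {0..1} \<times> {0..1} \<rightarrow> sphere 0 1"
      "\<forall>t\<in>{0..1}. H (0, t) = h t" "\<forall>t\<in>{0..1}. H (1, t) = h 0"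
      "\<forall>s\<in>{0..1}. H (s, 0) = h 0 \<and> H (s, 1) = h 1"
      unfolding homotopic_paths by (auto simp: pathstart_def pathfinish_def)
    have "continuous_map (top_of_set ({0..1} \<times> {0..1})) RP2 (\<lambda>z. {H z, - H z})"
      by (rule continuous_map_compose_on[OF continuous_map_antipodal_class H(1,2)])
    then have "path_homotopic RP2 l (\<lambda>t. q)"
      unfolding path_homotopic_def using H lh q'
      by (intro exI[of _ "\<lambda>z. {H z, - H z}"]) auto
    then show "homotopic_loops_rel RP2 q l (\<lambda>t. q)"
      using q q' by (intro path_homotopic_imp_homotopic_loops_rel) simp_all
  next
    assume "homotopic_loops_rel RP2 q l (\<lambda>t. q)"
    then obtain H where H: "continuous_map (top_of_set ({0..1::real} \<times> {0..1::real})) RP2 H"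
      "\<And>t. H (0, t) = l t" "\<And>t. H (1, t) = q"
      "\<And>s. s \<in> {0..1} \<Longrightarrow> H (s, 0) = q" "\<And>s. s \<in> {0..1} \<Longrightarrow> H (s, 1) = q"
      unfolding homotopic_loops_rel_def homotopic_with_def
      by (auto simp: prod_topology_subtopology_eu)
    have "continuous_map (top_of_set ({0..1} \<times> {0..1})) euclidean (RP2_matrix \<circ> H)"
      using H(1) continuous_map_RP2_matrix by (rule continuous_map_compose)
    then have cont: "continuous_on ({0..1} \<times> {0..1}) (RP2_matrix \<circ> H)" by simp
    have H_mem: "H z \<in> RP2_points" if "z \<in> {0..1} \<times> {0..1}" for z
      using H(1) that topspace_RP2 by (auto simp: continuous_map_def Pi_iff)
    have im: "RP2_matrix (H z) \<in> outer_square ` sphere 0 1" if z: "z \<in> {0..1} \<times> {0..1}" for z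
    proof -
      obtain v where "H z = {v, - v}" "v \<in> sphere 0 1"
        using H_mem[OF z] unfolding RP2_points_def by blast
      then show ?thesis using RP2_matrix_class by simp
    qed
    have Mq: "RP2_matrix q = outer_square (h 0)" by (simp add: q' RP2_matrix_class)
    have hom: "homotopic_paths (outer_square ` sphere 0 1) (outer_square \<circ> h) (\<lambda>t. outer_square (h 0))"
      unfolding homotopic_paths
    proof (intro exI conjI ballI)
      show "continuous_on ({0..1} \<times> {0..1}) (RP2_matrix \<circ> H)" by (rule cont)
      show "RP2_matrix \<circ> H \<in> {0..1} \<times> {0..1} \<rightarrow> outer_square ` sphere 0 1" using im by auto
      show "(RP2_matrix \<circ> H) (0, t) = (outer_square \<circ> h) t" if "t \<in> {0..1}" for t
        using that by (simp add: H lh RP2_matrix_class)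
      show "(RP2_matrix \<circ> H) (1, t) = outer_square (h 0)" for t by (simp add: H Mq)
      show "pathstart ((RP2_matrix \<circ> H) \<circ> Pair s) = pathstart (outer_square \<circ> h)" if "s \<in> {0..1}" for s
        using that by (simp add: pathstart_def H Mq)
      show "pathfinish ((RP2_matrix \<circ> H) \<circ> Pair s) = pathfinish (outer_square \<circ> h)" if "s \<in> {0..1}" for s
        using that lh[of 1] q' RP2_matrix_class[of "h 1"] by (simp add: pathfinish_def H flip: Mq)
    qed
    have "h 0 \<in> sphere 0 1" unfolding h_def by (rule half_turns_sphere)
    then have "pathfinish h = pathfinish (\<lambda>t. h 0)"
    proof (intro covering_space_monodromy[OF covering_space_outer_square _ _ _ _ hom])
      show "path (outer_square \<circ> h)" "path (\<lambda>t. outer_square (h 0))"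
        using homotopic_paths_imp_path[OF hom] by auto
      show "path_image (outer_square \<circ> h) \<subseteq> outer_square ` sphere 0 1"
        "path_image (\<lambda>t. outer_square (h 0)) \<subseteq> outer_square ` sphere 0 1"
        using homotopic_paths_imp_subset[OF hom] by auto
    qed (use h in \<open>auto simp: path_def path_image_def pathstart_def\<close>)
    then have "half_turns (c 0 + of_int k) = half_turns (c 0)"
      by (simp add: pathfinish_def h_def k)
    moreover have "half_turns (c 0) \<noteq> 0" using half_turns_sphere[of "c 0"] by auto
    ultimately show "even k"
      by (auto simp: half_turns_shift vec_eq_iff split: if_splits)
  }
qed

section \<open>Primitives of integral cocycles along paths\<close>

text \<open>Finitely many maps from compact spaces that cover a Hausdorff space form together a
  closed surjection, hence a quotient map. It serves for skeleta, for skeleta times the interval,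
  and for the circle as an image of the interval.\<close>

lemma continuous_map_from_compact_images:
  assumes X: "Hausdorff_space X" and I: "finite I"
    and Q: "\<And>i. i \<in> I \<Longrightarrow> compact_space (Q i)"
    and q: "\<And>i. i \<in> I \<Longrightarrow> continuous_map (Q i) X (q i)"
    and cover: "topspace X \<subseteq> (\<Union>i\<in>I. q i ` topspace (Q i))"
    and g: "\<And>i. i \<in> I \<Longrightarrow> continuous_map (Q i) Y (\<lambda>x. g (q i x))"
  shows "continuous_map X Y g"
  unfolding continuous_map_closedin
proof (intro conjI allI impI Pi_I)
  fix x assume "x \<in> topspace X"
  then obtain i y where "i \<in> I" "y \<in> topspace (Q i)" "x = q i y" using cover by blast
  then show "g x \<in> topspace Y" using g[of i] by (auto simp: continuous_map_def Pi_iff)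
next
  fix C assume C: "closedin Y C"
  have "{x \<in> topspace X. g x \<in> C} = (\<Union>i\<in>I. q i ` {y \<in> topspace (Q i). g (q i y) \<in> C})"
    using cover q by (fastforce simp: continuous_map_def Pi_iff)
  moreover have "closedin X (q i ` {y \<in> topspace (Q i). g (q i y) \<in> C})" if i: "i \<in> I" for i
  proof -
    have "closedin (Q i) {y \<in> topspace (Q i). g (q i y) \<in> C}"
      using g[OF i] C by (rule closedin_continuous_map_preimage)
    then have "compactin (Q i) {y \<in> topspace (Q i). g (q i y) \<in> C}"
      using Q[OF i] by (rule closedin_compact_space[rotated])
    then have "compactin X (q i ` {y \<in> topspace (Q i). g (q i y) \<in> C})"
      using q[OF i] by (rule image_compactin)
    then show ?thesis using X by (rule compactin_imp_closedin[rotated])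
  qed
  ultimately show "closedin X {x \<in> topspace X. g x \<in> C}"
    using I by (auto intro!: closedin_Union)
qed

lemma continuous_on_local_cball:
  fixes f :: "'b::metric_space \<Rightarrow> 'c::topological_space"
  assumes "\<And>x. x \<in> A \<Longrightarrow> \<exists>e>0. continuous_on (A \<inter> cball x e) f"
  shows "continuous_on A f"
  unfolding continuous_on_eq_continuous_within
proof
  fix x assume x: "x \<in> A"
  then obtain e where e: "e > 0" "continuous_on (A \<inter> cball x e) f" using assms by blast
  then have "continuous (at x within A \<inter> cball x e) f"
    using x by (simp add: continuous_on_eq_continuous_within)
  moreover have "at x within A \<inter> cball x e = at x within A"
    by (rule at_within_nhd[of x "ball x e"]) (use e in auto)
  ultimately show "continuous (at x within A) f" by simp
qed

lemma continuous_on_gt_local_cball: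
  fixes f :: "'b::metric_space \<Rightarrow> real"
  assumes "continuous_on A f" "x \<in> A" "c < f x"
  obtains e where "e > 0" "\<And>y. y \<in> A \<inter> cball x e \<Longrightarrow> c < f y"
proof -
  obtain d where d: "d > 0" "\<And>y. y \<in> A \<Longrightarrow> dist y x < d \<Longrightarrow> dist (f y) (f x) < f x - c"
    using assms unfolding continuous_on_iff by (metis diff_gt_0_iff_gt)
  have "c < f y" if "y \<in> A \<inter> cball x (d/2)" for y
    using d(2)[of y] d(1) that by (auto simp: dist_commute dist_real_def)
  then show thesis using that[of "d/2"] d(1) by simp
qed

text \<open>Away from the origin this is a composition with \<open>sgn\<close>. At the origin the
  factor \<open>norm v\<close> tends to 0 while \<open>f\<close> is bounded on the compact
  sphere.\<close>

lemma continuous_on_radial_extension: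
  fixes V :: "'b::real_normed_vector set" and f :: "'b \<Rightarrow> real"
  assumes f: "continuous_on (V \<inter> sphere 0 1) f" and V: "compact (V \<inter> sphere 0 1)"
    and scale: "\<And>r v. v \<in> V \<Longrightarrow> r *\<^sub>R v \<in> V"
  shows "continuous_on (V \<inter> cball 0 1) (\<lambda>v. norm v * f (sgn v))"
  unfolding continuous_on_eq_continuous_within
proof
  have sgn: "sgn v \<in> V \<inter> sphere 0 1" if "v \<in> V" "v \<noteq> 0" for v
    using that scale by (auto simp: sgn_div_norm)
  fix v assume v: "v \<in> V \<inter> cball 0 1"
  show "continuous (at v within V \<inter> cball 0 1) (\<lambda>v. norm v * f (sgn v))"
  proof (cases "v = 0")
    case False
    have "continuous_on (V \<inter> cball 0 1 - {0}) sgn"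
      by (auto simp: sgn_div_norm intro!: continuous_intros)
    moreover have "sgn ` (V \<inter> cball 0 1 - {0}) \<subseteq> V \<inter> sphere 0 1" using sgn by blast
    ultimately have "continuous_on (V \<inter> cball 0 1 - {0}) (\<lambda>v. f (sgn v))"
      by (rule continuous_on_compose2[OF f])
    then have "continuous_on (V \<inter> cball 0 1 - {0}) (\<lambda>v. norm v * f (sgn v))"
      by (intro continuous_intros)
    then have "continuous (at v within V \<inter> cball 0 1 - {0}) (\<lambda>v. norm v * f (sgn v))"
      using v False by (simp add: continuous_on_eq_continuous_within)
    moreover have "at v within V \<inter> cball 0 1 - {0} = at v within V \<inter> cball 0 1"
      by (rule at_within_nhd[of v "- {0}"]) (use False in auto)
    ultimately show ?thesis by simp
  next
    case True
    have "bounded (f ` (V \<inter> sphere 0 1))"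
      using f V by (intro compact_imp_bounded compact_continuous_image)
    then obtain M where M: "\<And>w. w \<in> V \<inter> sphere 0 1 \<Longrightarrow> \<bar>f w\<bar> \<le> M"
      by (force simp: bounded_real)
    have "((\<lambda>w. norm w * f (sgn w)) \<longlongrightarrow> 0) (at 0 within V \<inter> cball 0 1)"
    proof (rule Lim_null_comparison)
      have "norm (norm w * f (sgn w)) \<le> norm w * M" if "w \<in> V" for w
        using M sgn[OF that] by (cases "w = 0") (auto simp: abs_mult intro!: mult_left_mono)
      then show "\<forall>\<^sub>F w in at 0 within V \<inter> cball 0 1. norm (norm w * f (sgn w)) \<le> norm w * M"
        by (auto simp: eventually_at_filter)
      have "((\<lambda>w. norm w * M) \<longlongrightarrow> norm (0::'b) * M) (at 0 within V \<inter> cball 0 1)"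
        by (intro tendsto_intros)
      then show "((\<lambda>w. norm w * M) \<longlongrightarrow> 0) (at (0::'b) within V \<inter> cball 0 1)" by simp
    qed
    then show ?thesis using True by (simp add: continuous_within)
  qed
qed

section \<open>Values of a 1-cocycle on paths\<close>

lemma cocycle_cong:
  assumes "\<And>t. t \<in> {0..1} \<Longrightarrow> g t = h t"
  shows "z (path_simplex g) = z (path_simplex h)"
  using path_simplex_cong[of g h] assms by simp

lemma cocycle_const:
  assumes "z \<in> cocycles K 1" "x \<in> topspace K"
  shows "z (path_simplex (\<lambda>t. x)) = 0"
  using cocycle_triangle[of z K "{0}" "\<lambda>t::real. x" 0 0 0] assms by simp

lemma cocycle_subpath:
  assumes "z \<in> cocycles K 1" "pathin K \<sigma>" "a \<in> {0..1}" "b \<in> {0..1}" "c \<in> {0..1}"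
  shows "z (path_simplex (\<lambda>r. \<sigma> (linepath a b r))) + z (path_simplex (\<lambda>r. \<sigma> (linepath b c r)))
       = z (path_simplex (\<lambda>r. \<sigma> (linepath a c r)))"
  using assms by (intro cocycle_triangle[of _ K "{0..1}"]) (auto simp: pathin_def)

text \<open>Both sides equal the value on the diagonal from \<open>(a, 0)\<close> to
  \<open>(b, 1)\<close>.\<close>

lemma cocycle_square:
  assumes z: "z \<in> cocycles K 1" and T: "continuous_map (top_of_set (J \<times> {0..1})) K T"
    and J: "convex J" "a \<in> J" "b \<in> (J :: real set)"
  shows "z (path_simplex (\<lambda>r. T (linepath a b r, 0))) + z (path_simplex (\<lambda>r. T (b, r)))
       = z (path_simplex (\<lambda>r. T (a, r))) + z (path_simplex (\<lambda>r. T (linepath a b r, 1)))"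
proof -
  have S: "convex (J \<times> {0..1::real})" using J by (intro convex_Times) auto
  have l: "linepath (s, u) (t, w) r = (linepath s t r, linepath u w r)" for s t u w r :: real
    by (simp add: linepath_def)
  have c: "linepath s s r = s" "linepath 0 1 r = r" for s r :: real
    by (simp_all add: linepath_def algebra_simps)
  note tri = cocycle_triangle[OF z T S, of "(a, 0)" _ "(b, 1)", unfolded l c]
  show ?thesis using tri[of "(b, 0)", unfolded l c] tri[of "(a, 1)", unfolded l c] J by simp
qed

text \<open>Apply \<open>cocycle_square\<close> to the cone over \<open>\<tau>\<close>: one side of
  the square collapses to the apex and contributes 0. Thus moving the end of a radius along
  \<open>\<tau>\<close> changes its value by that of the path travelled.\<close>

lemma cocycle_cone:
  fixes \<Psi> :: "'b::real_normed_vector \<Rightarrow> 'a" and \<tau> :: "real \<Rightarrow> 'b"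
  assumes z: "z \<in> cocycles K 1" and \<Psi>: "continuous_map (top_of_set D) K \<Psi>"
    and D: "convex D" "0 \<in> D" and \<tau>: "continuous_on J \<tau>" "\<tau> \<in> J \<rightarrow> D"
    and J: "convex J" "a \<in> J" "b \<in> J"
  shows "z (path_simplex (\<lambda>r. \<Psi> (r *\<^sub>R \<tau> b)))
       = z (path_simplex (\<lambda>r. \<Psi> (r *\<^sub>R \<tau> a))) + z (path_simplex (\<lambda>r. \<Psi> (\<tau> (linepath a b r))))"
proof -
  have "continuous_on (J \<times> {0..1}) (\<lambda>z. snd z *\<^sub>R \<tau> (fst z))"
    by (intro continuous_intros continuous_on_compose2[OF \<tau>(1)]) auto
  moreover have "r *\<^sub>R v \<in> D" if "v \<in> D" "r \<in> {0..1}" for r v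
    using convexD_alt[OF D(1,2) that(1), of r] that(2) by simp
  then have "(\<lambda>z. snd z *\<^sub>R \<tau> (fst z)) \<in> J \<times> {0..1} \<rightarrow> D" using \<tau>(2) by (auto simp: Pi_iff)
  ultimately have "continuous_map (top_of_set (J \<times> {0..1})) K (\<lambda>z. \<Psi> (snd z *\<^sub>R \<tau> (fst z)))"
    by (rule continuous_map_compose_on[OF \<Psi>])
  from cocycle_square[OF z this J] show ?thesis
    using D(2) \<Psi> cocycle_const[OF z, of "\<Psi> 0"] by (auto simp: continuous_map_def Pi_iff)
qed

text \<open>Integrality of the cocycle makes this say that \<open>F\<close> modulo the integers, followed along any
  path, has a continuous real lift whose increment is that of \<open>F\<close> plus the value of \<open>z\<close>.\<close>
definition primitive_along_paths ::
  "(((nat \<Rightarrow> real) \<Rightarrow> 'a) \<Rightarrow> int) \<Rightarrow> 'a topology \<Rightarrow> ('a \<Rightarrow> real) \<Rightarrow> bool" where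
  "primitive_along_paths z X F \<longleftrightarrow>
     (\<forall>\<sigma>. pathin X \<sigma> \<longrightarrow>
        continuous_on {0..1} (\<lambda>t. F (\<sigma> t) + z (path_simplex (\<lambda>r. \<sigma> (linepath 0 t r)))))"

lemma primitive_along_pathsD:
  "primitive_along_paths z X F \<Longrightarrow> pathin X \<sigma> \<Longrightarrow>
     continuous_on {0..1} (\<lambda>t. F (\<sigma> t) + z (path_simplex (\<lambda>r. \<sigma> (linepath 0 t r))))"
  unfolding primitive_along_paths_def by blast

section \<open>Finite 2-complexes\<close>

text \<open>Cells of dimension at most 2 are modelled on subspaces of the complex plane.\<close>
definition cell_span :: "nat \<Rightarrow> complex set" where
  "cell_span n = {w. (n < 2 \<longrightarrow> Im w = 0) \<and> (n < 1 \<longrightarrow> Re w = 0)}"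

abbreviation "cell_disk n \<equiv> cell_span n \<inter> cball 0 1"
abbreviation "cell_ball n \<equiv> cell_span n \<inter> ball 0 1"
abbreviation "cell_sphere n \<equiv> cell_span n \<inter> sphere 0 1"

lemma subspace_cell_span: "subspace (cell_span n)"
  by (auto simp: cell_span_def subspace_def)

lemma cell_span_scaleR: "v \<in> cell_span n \<Longrightarrow> r *\<^sub>R v \<in> cell_span n"
  by (auto simp: cell_span_def)

lemma compact_cell_disk: "compact (cell_disk n)"
  and compact_cell_sphere: "compact (cell_sphere n)"
  using closed_subspace[OF subspace_cell_span] by (auto simp: closed_Int_compact)

lemma convex_cell_disk: "convex (cell_disk n)"
  by (intro convex_Int subspace_imp_convex subspace_cell_span convex_cball)

lemma zero_in_cell_disk: "0 \<in> cell_disk n"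
  by (simp add: cell_span_def)

text \<open>Radial flow fixing the unit sphere; at time 1 it has carried all \<open>v\<close> with
  \<open>norm v \<ge> 1/2\<close> onto the sphere.\<close>
definition push_out :: "real \<Rightarrow> complex \<Rightarrow> complex" where
  "push_out s v = (1 - s + s / max (norm v) (1/2)) *\<^sub>R v"

lemma continuous_on_push_out: "continuous_on S (\<lambda>z. push_out (fst z) (snd z))"
proof -
  \<comment> \<open>The cut-off at 1/2 keeps the denominator positive, which makes the flow
    continuous at the origin too.\<close>
  have "max (norm v) (1/2) \<noteq> 0" for v :: complex by (auto simp: max_def)
  then show ?thesis unfolding push_out_def by (intro continuous_intros) auto
qed

lemma push_out_0 [simp]: "push_out 0 v = v"
  by (simp add: push_out_def)

lemma push_out_sphere: "norm v = 1 \<Longrightarrow> push_out s v = v"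
  by (simp add: push_out_def)

text \<open>In the outer part of the disk the flow line of \<open>v\<close> is the radial segment to
  the sphere, so it is a side of the degenerate triangle with vertices \<open>0\<close>,
  \<open>v\<close> and \<open>sgn v\<close>.\<close>

lemma push_out_linepath:
  assumes "norm v > 1/2"
  shows "push_out r v = linepath v (sgn v) r"
proof -
  have "max (norm v) (1/2) = norm v" using assms by linarith
  then show ?thesis
    by (simp only: push_out_def linepath_def sgn_div_norm scaleR_add_left scaleR_scaleR divide_inverse)
qed

lemma push_out_1: "norm v > 1/2 \<Longrightarrow> push_out 1 v = sgn v"
  by (simp add: push_out_linepath linepath_1')

lemma push_out_in_cell_disk:
  assumes "v \<in> cell_disk n" "s \<in> {0..1}"
  shows "push_out s v \<in> cell_disk n"
proof -
  define m where "m = max (norm v) (1/2)"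
  have m: "m > 0" "norm v \<le> m" by (auto simp: m_def)
  have "norm (push_out s v) = (1 - s) * norm v + s * (norm v / m)"
    using assms m(1) by (simp add: push_out_def flip: m_def) (simp add: algebra_simps)
  also have "\<dots> \<le> (1 - s) * 1 + s * 1"
    using assms m by (intro add_mono mult_left_mono) (auto simp: divide_simps)
  finally show ?thesis
    using assms by (simp add: push_out_def cell_span_scaleR)
qed

text \<open>\<open>cells_disjoint\<close> combines the disjointness of the open cells with the
  injectivity of each characteristic map on its open ball.\<close>

locale finite_2_complex =
  fixes K :: "'a topology" and C :: "(nat \<times> (complex \<Rightarrow> 'a)) set"
  assumes Hausdorff: "Hausdorff_space K"
    and finite_cells: "finite C"
    and cell_map: "(n, \<Psi>) \<in> C \<Longrightarrow> continuous_map (top_of_set (cell_disk n)) K \<Psi>"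
    and cell_boundary: "(n, \<Psi>) \<in> C \<Longrightarrow> v \<in> cell_sphere n \<Longrightarrow>
      \<exists>m \<Psi>' w. (m, \<Psi>') \<in> C \<and> m < n \<and> w \<in> cell_ball m \<and> \<Psi> v = \<Psi>' w"
    and cell_dim: "(n, \<Psi>) \<in> C \<Longrightarrow> n \<le> 2"
    and cells_cover: "x \<in> topspace K \<Longrightarrow> \<exists>n \<Psi> v. (n, \<Psi>) \<in> C \<and> v \<in> cell_ball n \<and> x = \<Psi> v"
    and cells_disjoint: "(n, \<Psi>) \<in> C \<Longrightarrow> v \<in> cell_ball n \<Longrightarrow> (m, \<Psi>') \<in> C \<Longrightarrow> w \<in> cell_ball m \<Longrightarrow>
      \<Psi> v = \<Psi>' w \<Longrightarrow> n = m \<and> \<Psi> = \<Psi>' \<and> v = w"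
begin

text \<open>Indexing: \<open>skel k\<close> consists of the cells of dimension less than \<open>k\<close>.\<close>
definition skel :: "nat \<Rightarrow> 'a set" where
  "skel k = {\<Psi> v | n \<Psi> v. (n, \<Psi>) \<in> C \<and> n < k \<and> v \<in> cell_ball n}"

lemma skelI: "(n, \<Psi>) \<in> C \<Longrightarrow> n < k \<Longrightarrow> v \<in> cell_ball n \<Longrightarrow> \<Psi> v \<in> skel k"
  unfolding skel_def by blast

lemma skelE:
  assumes "x \<in> skel k"
  obtains n \<Psi> v where "(n, \<Psi>) \<in> C" "n < k" "v \<in> cell_ball n" "x = \<Psi> v"
  using assms unfolding skel_def by blast

lemma cell_in_topspace:
  assumes "(n, \<Psi>) \<in> C" "v \<in> cell_disk n"
  shows "\<Psi> v \<in> topspace K"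
  using continuous_map_image_subset_topspace[OF cell_map[OF assms(1)]] assms(2) by auto

lemma cell_sphere_in_skel:
  assumes "(n, \<Psi>) \<in> C" "v \<in> cell_sphere n"
  shows "\<Psi> v \<in> skel n"
  using cell_boundary[OF assms] skelI by metis

lemma skel_mono:
  assumes "k \<le> l"
  shows "skel k \<subseteq> skel l"
proof
  fix x assume "x \<in> skel k"
  then show "x \<in> skel l" using assms by (elim skelE) (simp add: skelI)
qed

lemma cell_disk_in_skel:
  assumes "(n, \<Psi>) \<in> C" "v \<in> cell_disk n" "n < k"
  shows "\<Psi> v \<in> skel k"
proof (cases "v \<in> cell_ball n")
  case True
  then show ?thesis using assms skelI by simp
next
  case False
  then have "v \<in> cell_sphere n" using assms(2) by auto
  then show ?thesis
    using cell_sphere_in_skel[OF assms(1)] skel_mono[of n k] assms(3) by auto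
qed

lemma cell_ball_notin_skel:
  assumes "(n, \<Psi>) \<in> C" "v \<in> cell_ball n" "k \<le> n"
  shows "\<Psi> v \<notin> skel k"
proof
  assume "\<Psi> v \<in> skel k"
  then obtain m \<Psi>' w where "(m, \<Psi>') \<in> C" "m < k" "w \<in> cell_ball m" "\<Psi> v = \<Psi>' w" by (rule skelE)
  then show False using cells_disjoint[OF assms(1,2)] assms(3) by (metis not_le)
qed

lemma skel_subset_topspace: "skel k \<subseteq> topspace K"
proof
  fix x assume "x \<in> skel k"
  then show "x \<in> topspace K" by (elim skelE) (simp add: cell_in_topspace)
qed

lemma skel_0: "skel 0 = {}"
  by (simp add: skel_def)

lemma skel_3: "skel 3 = topspace K"
proof
  show "topspace K \<subseteq> skel 3"
  proof
    fix x assume "x \<in> topspace K"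
    then obtain n \<Psi> v where "(n, \<Psi>) \<in> C" "v \<in> cell_ball n" "x = \<Psi> v" using cells_cover by blast
    moreover from this have "n < 3" using cell_dim by fastforce
    ultimately show "x \<in> skel 3" using skelI by simp
  qed
qed (rule skel_subset_topspace)

lemma skel_Suc_cases:
  assumes "x \<in> skel (Suc k)"
  obtains "x \<in> skel k" | \<Psi> v where "(k, \<Psi>) \<in> C" "v \<in> cell_ball k" "x = \<Psi> v"
proof -
  obtain n \<Psi> v where c: "(n, \<Psi>) \<in> C" "n < Suc k" "v \<in> cell_ball n" "x = \<Psi> v"
    using assms by (rule skelE)
  show thesis
  proof (cases "n = k")
    case True
    then show thesis using c that(2) by simp
  next
    case False
    then show thesis using c skelI that(1) by simp
  qed
qed

lemma topspace_skel [simp]: "topspace (subtopology K (skel k)) = skel k"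
  using skel_subset_topspace by (auto simp: topspace_subtopology)

lemma cell_map_skel:
  "(n, \<Psi>) \<in> C \<Longrightarrow> n < k \<Longrightarrow> continuous_map (top_of_set (cell_disk n)) (subtopology K (skel k)) \<Psi>"
  using cell_map[of n \<Psi>] cell_disk_in_skel[of n \<Psi> _ k] by (auto simp: continuous_map_in_subtopology)

section \<open>Skeleta as quotients of closed cells\<close>

lemma continuous_map_from_skel:
  assumes "\<And>n \<Psi>. (n, \<Psi>) \<in> C \<Longrightarrow> n < k \<Longrightarrow> continuous_map (top_of_set (cell_disk n)) Y (\<lambda>v. g (\<Psi> v))"
  shows "continuous_map (subtopology K (skel k)) Y g"
proof (rule continuous_map_from_compact_images[of _ "{c \<in> C. fst c < k}"
      "\<lambda>c. top_of_set (cell_disk (fst c))" snd])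
  show "topspace (subtopology K (skel k)) \<subseteq> (\<Union>c\<in>{c \<in> C. fst c < k}. snd c ` topspace (top_of_set (cell_disk (fst c))))"
    unfolding topspace_skel
  proof
    fix x assume "x \<in> skel k"
    then obtain n \<Psi> v where "(n, \<Psi>) \<in> C" "n < k" "v \<in> cell_ball n" "x = \<Psi> v" by (rule skelE)
    then show "x \<in> (\<Union>c\<in>{c \<in> C. fst c < k}. snd c ` topspace (top_of_set (cell_disk (fst c))))"
      by (intro UN_I[of "(n, \<Psi>)"]) auto
  qed
qed (use assms finite_cells Hausdorff cell_map_skel compact_cell_disk in
      \<open>auto simp: Hausdorff_space_subtopology compact_space_subtopology\<close>)

text \<open>The products of the interval with the closed cells are still compact and cover a
  Hausdorff space, so the quotient property survives multiplication by the interval.\<close>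

lemma continuous_map_from_skel_homotopy:
  fixes g :: "real \<times> 'a \<Rightarrow> 'b"
  assumes "\<And>n \<Psi>. (n, \<Psi>) \<in> C \<Longrightarrow> n < k \<Longrightarrow>
    continuous_map (top_of_set ({0..1} \<times> cell_disk n)) Y (\<lambda>z. g (fst z, \<Psi> (snd z)))"
  shows "continuous_map (prod_topology (top_of_set {0..1}) (subtopology K (skel k))) Y g"
proof (rule continuous_map_from_compact_images[of _ "{c \<in> C. fst c < k}"
      "\<lambda>c. top_of_set ({0..1} \<times> cell_disk (fst c))" "\<lambda>c z. (fst z, snd c (snd z))"])
  fix c assume "c \<in> {c \<in> C. fst c < k}"
  then have c: "(fst c, snd c) \<in> C" "fst c < k" by auto
  show "compact_space (top_of_set ({0..1::real} \<times> cell_disk (fst c)))"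
    using compact_cell_disk[of "fst c"] by (simp add: compact_space_subtopology compact_Times)
  have "continuous_map (top_of_set ({0..1} \<times> cell_disk (fst c))) (top_of_set {0..1}) (\<lambda>z. fst z :: real)"
    by (auto simp: continuous_on_fst)
  moreover have "continuous_map (top_of_set ({0..1::real} \<times> cell_disk (fst c))) (subtopology K (skel k)) (\<lambda>z. snd c (snd z))"
    using cell_map_skel[OF c] by (rule continuous_map_compose_on) (auto simp: continuous_on_snd)
  ultimately show "continuous_map (top_of_set ({0..1::real} \<times> cell_disk (fst c)))
      (prod_topology (top_of_set {0..1}) (subtopology K (skel k))) (\<lambda>z. (fst z, snd c (snd z)))"
    by (rule continuous_map_pairedI)
  show "continuous_map (top_of_set ({0..1} \<times> cell_disk (fst c))) Y (\<lambda>z. g (fst z, snd c (snd z)))"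
    using assms[OF c] .
next
  show "topspace (prod_topology (top_of_set {0..1::real}) (subtopology K (skel k))) \<subseteq>
    (\<Union>c\<in>{c \<in> C. fst c < k}. (\<lambda>z. (fst z, snd c (snd z))) ` topspace (top_of_set ({0..1::real} \<times> cell_disk (fst c))))"
  proof
    fix y assume "y \<in> topspace (prod_topology (top_of_set {0..1::real}) (subtopology K (skel k)))"
    then have y: "fst y \<in> {0..1::real}" "snd y \<in> skel k" by (auto simp del: topspace_subtopology)
    then obtain n \<Psi> v where "(n, \<Psi>) \<in> C" "n < k" "v \<in> cell_ball n" "snd y = \<Psi> v"
      unfolding skel_def by blast
    then have "(n, \<Psi>) \<in> {c \<in> C. fst c < k}"
      "y \<in> (\<lambda>z. (fst z, snd (n, \<Psi>) (snd z))) ` topspace (top_of_set ({0..1::real} \<times> cell_disk (fst (n, \<Psi>))))"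
      using y by (auto intro!: image_eqI[of _ _ "(fst y, v)"] simp: prod_eq_iff)
    then show "y \<in> (\<Union>c\<in>{c \<in> C. fst c < k}. (\<lambda>z. (fst z, snd c (snd z))) `
        topspace (top_of_set ({0..1::real} \<times> cell_disk (fst c))))" by blast
  qed
qed (use finite_cells Hausdorff in \<open>simp_all add: Hausdorff_space_subtopology Hausdorff_space_prod_topology\<close>)

text \<open>Glues \<open>f\<close> on the lower skeleton to the functions \<open>g \<Psi>\<close> on
  the \<open>k\<close>-cells. On an open \<open>k\<close>-cell the choice is forced: cell and
  interior coordinate of a point are unique.\<close>

definition attach :: "nat \<Rightarrow> ('a \<Rightarrow> 'b) \<Rightarrow> ((complex \<Rightarrow> 'a) \<Rightarrow> complex \<Rightarrow> 'b) \<Rightarrow> 'a \<Rightarrow> 'b" where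
  "attach k f g x = (if x \<in> skel k then f x else
     case (SOME c. (k, fst c) \<in> C \<and> snd c \<in> cell_ball k \<and> x = fst c (snd c)) of (\<Psi>, v) \<Rightarrow> g \<Psi> v)"

lemma attach_skel [simp]: "x \<in> skel k \<Longrightarrow> attach k f g x = f x"
  by (simp add: attach_def)

lemma attach_cell:
  assumes "(k, \<Psi>) \<in> C" "v \<in> cell_disk k" "v \<in> cell_sphere k \<Longrightarrow> f (\<Psi> v) = g \<Psi> v"
  shows "attach k f g (\<Psi> v) = g \<Psi> v"
proof (cases "v \<in> cell_ball k")
  case True
  define c where "c = (SOME c. (k, fst c) \<in> C \<and> snd c \<in> cell_ball k \<and> \<Psi> v = fst c (snd c))"
  have "(k, fst c) \<in> C \<and> snd c \<in> cell_ball k \<and> \<Psi> v = fst c (snd c)"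
    unfolding c_def by (rule someI[of _ "(\<Psi>, v)"]) (use assms True in simp)
  then have "c = (\<Psi>, v)"
    using cells_disjoint[OF assms(1) True] by (metis prod.collapse)
  then show ?thesis
    using cell_ball_notin_skel[OF assms(1) True] by (simp add: attach_def c_def)
next
  case False
  then have "v \<in> cell_sphere k" using assms(2) by auto
  then show ?thesis using assms cell_sphere_in_skel by simp
qed

lemma continuous_map_attach:
  assumes f: "continuous_map (subtopology K (skel k)) Y f"
    and g: "\<And>\<Psi>. (k, \<Psi>) \<in> C \<Longrightarrow> continuous_map (top_of_set (cell_disk k)) Y (g \<Psi>)"
    and fg: "\<And>\<Psi> v. (k, \<Psi>) \<in> C \<Longrightarrow> v \<in> cell_sphere k \<Longrightarrow> f (\<Psi> v) = g \<Psi> v"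
  shows "continuous_map (subtopology K (skel (Suc k))) Y (attach k f g)"
proof (rule continuous_map_from_skel)
  fix n \<Psi> assume c: "(n, \<Psi>) \<in> C" "n < Suc k"
  show "continuous_map (top_of_set (cell_disk n)) Y (\<lambda>v. attach k f g (\<Psi> v))"
  proof (cases "n = k")
    case True
    have "continuous_map (top_of_set (cell_disk k)) Y (g \<Psi>)" using g c True by simp
    then show ?thesis
      unfolding True
    proof (rule continuous_map_eq)
      fix v assume "v \<in> topspace (top_of_set (cell_disk k))"
      then show "g \<Psi> v = attach k f g (\<Psi> v)"
        using c True by (intro attach_cell[symmetric] fg) auto
    qed
  next
    case False
    then have "n < k" using c by simp
    have "continuous_map (top_of_set (cell_disk n)) Y (f \<circ> \<Psi>)"
      using cell_map_skel[OF c(1) \<open>n < k\<close>] f by (rule continuous_map_compose)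
    then show ?thesis
      by (rule continuous_map_eq) (use cell_disk_in_skel[OF c(1) _ \<open>n < k\<close>] in auto)
  qed
qed

text \<open>Exhibits \<open>skel k\<close> as a neighbourhood deformation retract in
  \<open>skel (Suc k)\<close>: points of \<open>skel k\<close> stay fixed, and the part of each
  \<open>k\<close>-cell with radius above 1/2 ends in \<open>skel k\<close>.\<close>

definition retract_homotopy :: "nat \<Rightarrow> real \<times> 'a \<Rightarrow> 'a" where
  "retract_homotopy k z = attach k (\<lambda>x. x) (\<lambda>\<Psi> v. \<Psi> (push_out (fst z) v)) (snd z)"

lemma retract_homotopy_skel [simp]: "x \<in> skel k \<Longrightarrow> retract_homotopy k (s, x) = x"
  by (simp add: retract_homotopy_def)

lemma retract_homotopy_cell:
  "(k, \<Psi>) \<in> C \<Longrightarrow> v \<in> cell_disk k \<Longrightarrow> retract_homotopy k (s, \<Psi> v) = \<Psi> (push_out s v)"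
  unfolding retract_homotopy_def fst_conv snd_conv
  by (rule attach_cell) (simp_all add: push_out_sphere)

lemma retract_homotopy_0:
  assumes "x \<in> skel (Suc k)"
  shows "retract_homotopy k (0, x) = x"
  using assms
proof (cases rule: skel_Suc_cases)
  case (2 \<Psi> v)
  then have "v \<in> cell_disk k" by simp
  then show ?thesis using 2 retract_homotopy_cell by simp
qed simp

lemma continuous_map_retract_homotopy:
  "continuous_map (prod_topology (top_of_set {0..1}) (subtopology K (skel (Suc k)))) K (retract_homotopy k)"
proof (rule continuous_map_from_skel_homotopy)
  fix n \<Psi> assume c: "(n, \<Psi>) \<in> C" "n < Suc k"
  show "continuous_map (top_of_set ({0..1} \<times> cell_disk n)) K (\<lambda>z. retract_homotopy k (fst z, \<Psi> (snd z)))"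
  proof (cases "n = k")
    case True
    have "continuous_map (top_of_set ({0..1} \<times> cell_disk k)) K (\<lambda>z. \<Psi> (push_out (fst z) (snd z)))"
      using cell_map[OF c(1)] unfolding True
      by (rule continuous_map_compose_on[OF _ continuous_on_push_out]) (use push_out_in_cell_disk in auto)
    then show ?thesis
      unfolding True by (rule continuous_map_eq) (use c True retract_homotopy_cell in auto)
  next
    case False
    have "continuous_map (top_of_set ({0..1::real} \<times> cell_disk n)) K (\<lambda>z. \<Psi> (snd z))"
      using cell_map[OF c(1)] by (rule continuous_map_compose_on) (auto simp: continuous_on_snd)
    then show ?thesis
      by (rule continuous_map_eq) (use cell_disk_in_skel[OF c(1), of _ k] c False in auto)
  qed
qed

text \<open>Closed cells are path connected and compact. Sorting the finitely many cells by whether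
  their centre can be reached from \<open>x\<close> gives two disjoint closed sets that cover
  \<open>K\<close>, so one of them is empty.\<close>

lemma path_connected_space_if_connected:
  assumes "connected_space K"
  shows "path_connected_space K"
proof -
  have cell_conn: "path_component_of K (\<Psi> 0) (\<Psi> v)" if c: "(n, \<Psi>) \<in> C" and v: "v \<in> cell_disk n" for n \<Psi> v
  proof -
    have "continuous_map (top_of_set {0..1}) K (\<lambda>t. \<Psi> (linepath 0 v t))"
      using cell_map[OF c]
    proof (rule continuous_map_compose_on)
      show "linepath 0 v \<in> {0..1} \<rightarrow> cell_disk n"
        using closed_segment_subset[OF zero_in_cell_disk v convex_cell_disk] linepath_in_path by blast
    qed (rule continuous_on_linepath)
    then show ?thesis
      unfolding path_component_of_def pathin_def
      by (intro exI[of _ "\<lambda>t. \<Psi> (linepath 0 v t)"]) (simp add: linepath_0' linepath_1')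
  qed
  have closed_union: "closedin K (\<Union>c\<in>B. snd c ` cell_disk (fst c))" if B: "B \<subseteq> C" for B
  proof (intro closedin_Union)
    show "finite ((\<lambda>c. snd c ` cell_disk (fst c)) ` B)"
      using finite_cells that finite_subset by blast
    fix S assume "S \<in> (\<lambda>c. snd c ` cell_disk (fst c)) ` B"
    then obtain c where "c \<in> C" and S: "S = snd c ` cell_disk (fst c)" using B by blast
    then have "(fst c, snd c) \<in> C" by simp
    then have "compactin K (snd c ` cell_disk (fst c))"
      using compact_cell_disk[of "fst c"]
      by (intro image_compactin[OF _ cell_map]) (auto simp: compactin_subtopology)
    then show "closedin K S" unfolding S by (rule compactin_imp_closedin[OF Hausdorff])
  qed
  show ?thesis
    unfolding path_connected_space_iff_path_component
  proof (intro ballI)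
    fix x y assume x: "x \<in> topspace K" and y: "y \<in> topspace K"
    define A where "A = {c \<in> C. path_component_of K x (snd c 0)}"
    define P Q where "P = (\<Union>c\<in>A. snd c ` cell_disk (fst c))" and "Q = (\<Union>c\<in>C - A. snd c ` cell_disk (fst c))"
    have P: "path_component_of K x w" if "w \<in> P" for w
    proof -
      obtain c v where c: "c \<in> A" "v \<in> cell_disk (fst c)" "w = snd c v"
        using \<open>w \<in> P\<close> unfolding P_def by blast
      then have "path_component_of K x (snd c 0)" "path_component_of K (snd c 0) w"
        using cell_conn[of "fst c" "snd c" v] by (simp_all add: A_def)
      then show ?thesis by (rule path_component_of_trans)
    qed
    have Q: "\<not> path_component_of K x w" if "w \<in> Q" for w
    proof -
      obtain c v where c: "c \<in> C - A" "v \<in> cell_disk (fst c)" "w = snd c v"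
        using \<open>w \<in> Q\<close> unfolding Q_def by blast
      then have "path_component_of K w (snd c 0)" "\<not> path_component_of K x (snd c 0)"
        using cell_conn[of "fst c" "snd c" v] by (simp_all add: A_def path_component_of_sym)
      then show ?thesis using path_component_of_trans by metis
    qed
    have cover: "w \<in> P \<union> Q" if w: "w \<in> topspace K" for w
    proof -
      obtain n \<Psi> v where "(n, \<Psi>) \<in> C" "v \<in> cell_ball n" "w = \<Psi> v" using cells_cover[OF w] by blast
      then have "(n, \<Psi>) \<in> C" "w \<in> snd (n, \<Psi>) ` cell_disk (fst (n, \<Psi>))" by auto
      then show ?thesis unfolding P_def Q_def by blast
    qed
    have "closedin K P" "closedin K Q"
      unfolding P_def Q_def by (auto intro!: closed_union simp: A_def)
    moreover have "P \<inter> Q = {}" using P Q by blast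
    moreover have "x \<in> P" using x Q cover path_component_of_refl by fastforce
    ultimately have "Q = {}"
      using assms cover unfolding connected_space_closedin by blast
    then show "path_component_of K x y" using P cover[OF y] by blast
  qed
qed

end

section \<open>Construction of a primitive over the skeleta\<close>

context finite_2_complex
begin

text \<open>For a 2-cell, the cone identity turns this function, read along the boundary circle,
  into the lift of \<open>F\<close> along the attaching loop plus a constant. Being defined on the
  circle itself, it shows that the lift closes up; this is where the disk filling the loop is used.
  In lower dimensions the sphere has at most two points.\<close>

lemma continuous_on_boundary_primitive:
  assumes z: "z \<in> cocycles K 1" and F: "primitive_along_paths z (subtopology K (skel k)) F"
    and c: "(k, \<Psi>) \<in> C"
  shows "continuous_on (cell_sphere k) (\<lambda>v. F (\<Psi> v) + z (path_simplex (\<lambda>r. \<Psi> (r *\<^sub>R v))))"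
    (is "continuous_on _ ?h")
proof -
  consider "k = 2" | "k < 2" using cell_dim[OF c] by linarith
  then show ?thesis
  proof cases
    case 1
    define e where "e t = cis (2 * pi * t)" for t
    have cont_e: "continuous_on S e" for S unfolding e_def by (intro continuous_intros)
    have sphere: "cell_sphere k = sphere 0 1" using 1 by (auto simp: cell_span_def)
    have e_sphere: "e t \<in> cell_sphere k" for t unfolding sphere by (simp add: e_def)
    then have e_disk: "e t \<in> cell_disk k" for t by (simp add: less_imp_le)
    have \<sigma>: "pathin (subtopology K (skel k)) (\<lambda>t. \<Psi> (e t))"
      unfolding pathin_def continuous_map_in_subtopology
    proof
      show "continuous_map (top_of_set {0..1}) K (\<lambda>t. \<Psi> (e t))"
        using e_disk by (intro continuous_map_compose_on[OF cell_map[OF c] cont_e]) blast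
    qed (use e_sphere cell_sphere_in_skel[OF c] in auto)
    have cone: "?h (e t) = z (path_simplex (\<lambda>r. \<Psi> (r *\<^sub>R e 0))) +
        (F (\<Psi> (e t)) + z (path_simplex (\<lambda>r. \<Psi> (e (linepath 0 t r)))))" if "t \<in> {0..1}" for t
      using cocycle_cone[OF z cell_map[OF c] convex_cell_disk zero_in_cell_disk cont_e, of "{0..1}" 0 t]
        e_disk that by (simp add: Pi_iff)
    have "continuous_on {0..1} (\<lambda>t. F (\<Psi> (e t)) + z (path_simplex (\<lambda>r. \<Psi> (e (linepath 0 t r)))))"
      by (rule primitive_along_pathsD[OF F \<sigma>])
    then have "continuous_on {0..1} (\<lambda>t. z (path_simplex (\<lambda>r. \<Psi> (r *\<^sub>R e 0))) +
        (F (\<Psi> (e t)) + z (path_simplex (\<lambda>r. \<Psi> (e (linepath 0 t r))))))"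
      by (rule continuous_on_add[OF continuous_on_const])
    then have cont: "continuous_on {0..1} (\<lambda>t. ?h (e t))"
      by (rule continuous_on_eq) (rule cone[symmetric])
    \<comment> \<open>The circle is a quotient of the interval under \<open>e\<close>, so continuity
      on the interval descends to it.\<close>
    have "continuous_map (top_of_set (sphere 0 1)) euclideanreal ?h"
    proof (rule continuous_map_from_compact_images[of _ "{()}" "\<lambda>_. top_of_set {0..1}" "\<lambda>_. e"])
      show "topspace (top_of_set (sphere 0 1)) \<subseteq> (\<Union>i\<in>{()}. e ` topspace (top_of_set {0..1}))"
      proof
        fix v :: complex assume "v \<in> topspace (top_of_set (sphere 0 1))"
        then have "v = e (Arg2pi v / (2 * pi))"
          using Arg2pi_eq[of v] by (simp add: e_def cis_conv_exp mult.commute)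
        moreover have "Arg2pi v / (2 * pi) \<in> {0..1}"
          using Arg2pi[of v] by (simp add: divide_simps)
        ultimately show "v \<in> (\<Union>i\<in>{()}. e ` topspace (top_of_set {0..1}))" by auto
      qed
      show "continuous_map (top_of_set {0..1}) (top_of_set (sphere 0 1)) e"
        using cont_e by (auto simp: e_def)
    qed (use cont in \<open>auto simp: Hausdorff_space_subtopology compact_space_subtopology\<close>)
    then show ?thesis using sphere by simp
  next
    case 2
    have "cell_sphere k \<subseteq> {1, -1}"
    proof
      fix v assume "v \<in> cell_sphere k"
      then have "Im v = 0" "(Re v)\<^sup>2 = 1"
        using 2 by (auto simp: cell_span_def cmod_def real_sqrt_eq_1_iff)
      then show "v \<in> {1, -1}" by (auto simp: complex_eq_iff power2_eq_1_iff)
    qed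
    then have "finite (cell_sphere k)" by (rule finite_subset) simp
    then show ?thesis by (rule continuous_on_finite)
  qed
qed

text \<open>\<open>h\<close> is the radial extension of the boundary function of the previous lemma.
  Subtracting the integer value on the radius makes the result agree with \<open>F\<close> on the
  boundary, so it glues, and leaves the class modulo 1 continuous on the closed cell. The pair of
  \<open>F'\<close> and \<open>h\<close> is returned because later continuity is read off from
  \<open>h\<close>.\<close>

lemma primitive_extension:
  assumes z: "z \<in> cocycles K 1" and F: "primitive_along_paths z (subtopology K (skel k)) F"
  shows "\<exists>F' h. (\<forall>x\<in>skel k. F' x = F x) \<and> primitive_along_paths z (subtopology K (skel (Suc k))) F' \<and>
    (\<forall>\<Psi>. (k, \<Psi>) \<in> C \<longrightarrow> continuous_on (cell_disk k) (h \<Psi> :: complex \<Rightarrow> real) \<and>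
      (\<forall>v\<in>cell_disk k. F' (\<Psi> v) = h \<Psi> v - real_of_int (z (path_simplex (\<lambda>r. \<Psi> (r *\<^sub>R v))))))"
proof -
  define cone where "cone \<Psi> v = real_of_int (z (path_simplex (\<lambda>r. \<Psi> (r *\<^sub>R v))))" for \<Psi> and v :: complex
  define h where "h \<Psi> v = norm v * (F (\<Psi> (sgn v)) + cone \<Psi> (sgn v))" for \<Psi> v
  define F' where "F' = attach k F (\<lambda>\<Psi> v. h \<Psi> v - cone \<Psi> v)"
  have cont_h: "continuous_on (cell_disk k) (h \<Psi>)" if "(k, \<Psi>) \<in> C" for \<Psi>
    unfolding h_def cone_def
    using continuous_on_boundary_primitive[OF z F that] compact_cell_sphere cell_span_scaleR
    by (rule continuous_on_radial_extension)
  have F'_skel: "F' x = F x" if "x \<in> skel k" for x using that by (simp add: F'_def)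
  have F'_cell: "F' (\<Psi> v) = h \<Psi> v - cone \<Psi> v" if "(k, \<Psi>) \<in> C" "v \<in> cell_disk k" for \<Psi> v
    unfolding F'_def using that by (intro attach_cell) (auto simp: h_def sgn_div_norm)
  have "continuous_on {0..1} (\<lambda>t. F' (\<sigma> t) + z (path_simplex (\<lambda>r. \<sigma> (linepath 0 t r))))" (is "continuous_on _ ?G")
    if \<sigma>: "pathin (subtopology K (skel (Suc k))) \<sigma>" for \<sigma>
  proof (rule continuous_on_local_cball)
    fix t0 :: real assume t0: "t0 \<in> {0..1}"
    have \<sigma>K: "pathin K \<sigma>" and \<sigma>_skel: "\<And>t. t \<in> {0..1} \<Longrightarrow> \<sigma> t \<in> skel (Suc k)"
      using \<sigma> by (auto simp: pathin_def continuous_map_in_subtopology)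
    \<comment> \<open>Splitting at \<open>t0\<close> leaves a constant and the value on the segment
      from \<open>t0\<close> to \<open>t\<close>, so only the behaviour near \<open>t0\<close>
      matters.\<close>
    have G: "?G t = F' (\<sigma> t) + z (path_simplex (\<lambda>r. \<sigma> (linepath 0 t0 r))) + z (path_simplex (\<lambda>r. \<sigma> (linepath t0 t r)))"
      if "t \<in> {0..1}" for t
      using cocycle_subpath[OF z \<sigma>K, of 0 t0 t] t0 that by simp
    have cont_\<sigma>: "continuous_on {0..1} (\<lambda>t. f (\<sigma> t))"
      if "continuous_map (subtopology K (skel (Suc k))) euclidean f" for f :: "'a \<Rightarrow> 'c::topological_space"
      using continuous_map_compose[OF \<sigma>[unfolded pathin_def] that] by (simp add: o_def)
    have J_lin: "linepath a b r \<in> {0..1} \<inter> cball t0 e"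
      if "a \<in> {0..1} \<inter> cball t0 e" "b \<in> {0..1} \<inter> cball t0 e" "r \<in> {0..1}" for a b r e
    proof -
      have "convex ({0..1} \<inter> cball t0 e)" by (intro convex_Int) auto
      then have "closed_segment a b \<subseteq> {0..1} \<inter> cball t0 e"
        using that by (intro closed_segment_subset)
      then show ?thesis using linepath_in_path[OF that(3), of a b] by blast
    qed
    from \<sigma>_skel[OF t0] show "\<exists>e>0. continuous_on ({0..1} \<inter> cball t0 e) ?G"
    proof (cases rule: skel_Suc_cases)
      case (2 \<Psi> v0)
      text \<open>Near a point of an open cell the coordinate is the quotient of two functions that
        extend continuously by zero.\<close>
      define b where "b = attach k (\<lambda>_. 0) (\<lambda>\<Psi>' v. if \<Psi>' = \<Psi> then 1 - norm v else 0)"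
      define c where "c = attach k (\<lambda>_. 0) (\<lambda>\<Psi>' v. if \<Psi>' = \<Psi> then (1 - norm v) *\<^sub>R v else 0)"
      have b_cell: "b (\<Psi>' v) = (if \<Psi>' = \<Psi> then 1 - norm v else 0)"
        and c_cell: "c (\<Psi>' v) = (if \<Psi>' = \<Psi> then (1 - norm v) *\<^sub>R v else 0)"
        if "(k, \<Psi>') \<in> C" "v \<in> cell_ball k" for \<Psi>' v
        unfolding b_def c_def using that by (subst attach_cell; auto)+
      have "continuous_map (subtopology K (skel (Suc k))) euclidean b"
        unfolding b_def by (rule continuous_map_attach) (auto intro!: continuous_intros)
      then have cont_b: "continuous_on {0..1} (\<lambda>t. b (\<sigma> t))" by (rule cont_\<sigma>)
      have "continuous_map (subtopology K (skel (Suc k))) euclidean c"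
        unfolding c_def by (rule continuous_map_attach) (auto intro!: continuous_intros)
      then have cont_c: "continuous_on {0..1} (\<lambda>t. c (\<sigma> t))" by (rule cont_\<sigma>)
      \<comment> \<open>Within \<open>skel (Suc k)\<close>, \<open>b\<close> is positive exactly on
        the open cell of \<open>\<Psi>\<close>, so the path stays in this cell as long as
        \<open>b\<close> is positive along it.\<close>
      have "0 < b (\<sigma> t0)" using 2 b_cell by simp
      then obtain e where e: "e > 0" "\<And>t. t \<in> {0..1} \<inter> cball t0 e \<Longrightarrow> 0 < b (\<sigma> t)"
        using continuous_on_gt_local_cball[OF cont_b t0] by blast
      define J where "J = {0..1} \<inter> cball t0 e"
      define v where "v t = c (\<sigma> t) /\<^sub>R b (\<sigma> t)" for t
      have v: "v t \<in> cell_ball k \<and> \<sigma> t = \<Psi> (v t)" if "t \<in> J" for t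
      proof -
        have "\<sigma> t \<in> skel (Suc k)" "b (\<sigma> t) > 0" using that e \<sigma>_skel by (auto simp: J_def)
        then show ?thesis
        proof (cases rule: skel_Suc_cases)
          case (2 \<Psi>' w)
          then have "\<Psi>' = \<Psi>" using \<open>b (\<sigma> t) > 0\<close> b_cell by (auto split: if_splits)
          then show ?thesis using 2 b_cell c_cell by (auto simp: v_def)
        qed (simp add: b_def)
      qed
      have v_disk: "v \<in> J \<rightarrow> cell_disk k" using v by (simp add: Pi_iff less_imp_le)
      have cont_v: "continuous_on J v"
        unfolding v_def using e(2)
        by (intro continuous_intros continuous_on_subset[OF cont_b] continuous_on_subset[OF cont_c])
           (force simp: J_def)+
      have J: "convex J" "t0 \<in> J" using t0 e by (auto simp: J_def intro!: convex_Int)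
      \<comment> \<open>By the cone identity the increment of \<open>z\<close> along the path
        cancels that of \<open>cone\<close>; what remains is \<open>h\<close> along the lifted path,
        up to a constant.\<close>
      have eq_G: "?G t = h \<Psi> (v t) + (z (path_simplex (\<lambda>r. \<sigma> (linepath 0 t0 r))) - cone \<Psi> (v t0))" if t: "t \<in> J" for t
      proof -
        have "z (path_simplex (\<lambda>r. \<sigma> (linepath t0 t r))) = z (path_simplex (\<lambda>r. \<Psi> (v (linepath t0 t r))))"
          using v J_lin[of t0 e t] J t by (intro cocycle_cong) (simp add: J_def)
        moreover have "cone \<Psi> (v t) = cone \<Psi> (v t0) + z (path_simplex (\<lambda>r. \<Psi> (v (linepath t0 t r))))"
          using cocycle_cone[OF z cell_map[OF 2(1)] convex_cell_disk zero_in_cell_disk cont_v v_disk J t]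
          by (simp add: cone_def)
        moreover have "F' (\<sigma> t) = h \<Psi> (v t) - cone \<Psi> (v t)"
          using v[OF t] F'_cell[OF 2(1), of "v t"] by auto
        ultimately show ?thesis using G[of t] t by (simp add: J_def)
      qed
      have "continuous_on J (\<lambda>t. h \<Psi> (v t) + (z (path_simplex (\<lambda>r. \<sigma> (linepath 0 t0 r))) - cone \<Psi> (v t0)))"
        using v_disk
        by (intro continuous_on_add continuous_on_const continuous_on_compose2[OF cont_h[OF 2(1)] cont_v])
           blast
      then have "continuous_on J ?G" by (rule continuous_on_eq) (rule eq_G[symmetric])
      with e(1) show ?thesis by (auto simp: J_def)
    next
      case 1
      \<comment> \<open>\<open>d\<close> is the radius in \<open>k\<close>-cells and 1 on
        \<open>skel k\<close>, so \<open>1/2 < d\<close> marks the points that the flow has brought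
        into \<open>skel k\<close> by time 1. \<open>err\<close> is the change of \<open>h\<close>
        under the flow, continuous and zero on \<open>skel k\<close>.\<close>
      define d where "d = attach k (\<lambda>_. 1) (\<lambda>\<Psi> v. norm v)"
      define err where "err = attach k (\<lambda>_. 0) (\<lambda>\<Psi> v. h \<Psi> v - h \<Psi> (push_out 1 v))"
      define \<rho> where "\<rho> = retract_homotopy k"
      have "continuous_map (subtopology K (skel (Suc k))) euclidean d"
        unfolding d_def by (rule continuous_map_attach) (auto intro!: continuous_intros)
      then have cont_d: "continuous_on {0..1} (\<lambda>t. d (\<sigma> t))" by (rule cont_\<sigma>)
      have cont_push: "continuous_on (cell_disk k) (push_out 1)"
        using continuous_on_compose2[OF continuous_on_push_out[of UNIV], of "cell_disk k" "\<lambda>v. (1, v)"]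
        by (simp add: continuous_on_Pair)
      have "continuous_map (subtopology K (skel (Suc k))) euclidean err"
        unfolding err_def
      proof (rule continuous_map_attach)
        fix \<Psi> assume c: "(k, \<Psi>) \<in> C"
        have "continuous_on (cell_disk k) (\<lambda>v. h \<Psi> v - h \<Psi> (push_out 1 v))"
          using push_out_in_cell_disk[of _ k 1]
          by (intro continuous_intros cont_h[OF c] continuous_on_compose2[OF cont_h[OF c] cont_push]) auto
        then show "continuous_map (top_of_set (cell_disk k)) euclidean (\<lambda>v. h \<Psi> v - h \<Psi> (push_out 1 v))"
          by simp
      qed (auto simp: push_out_sphere)
      then have cont_err: "continuous_on {0..1} (\<lambda>t. err (\<sigma> t))" by (rule cont_\<sigma>)
      have "1/2 < d (\<sigma> t0)" using 1 by (simp add: d_def)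
      then obtain e where e: "e > 0" "\<And>t. t \<in> {0..1} \<inter> cball t0 e \<Longrightarrow> 1/2 < d (\<sigma> t)"
        using continuous_on_gt_local_cball[OF cont_d t0] by blast
      define J where "J = {0..1} \<inter> cball t0 e"
      have J: "convex J" "t0 \<in> J" using t0 e by (auto simp: J_def intro!: convex_Int)
      define a b where "a = max 0 (t0 - e)" and "b = min 1 (t0 + e)"
      have J_eq: "J = {a..b}" and ab: "0 \<le> a" "a \<le> b" "b \<le> 1"
        using t0 e(1) by (auto simp: J_def a_def b_def dist_real_def)
      have key: "\<rho> (1, x) \<in> skel k \<and> F' x = F (\<rho> (1, x)) + z (path_simplex (\<lambda>r. \<rho> (r, x))) + err x"
        if x: "x \<in> skel (Suc k)" "1/2 < d x" for x
        using x(1)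
      proof (cases rule: skel_Suc_cases)
        case 1
        then show ?thesis
          using cocycle_const[OF z, of x] skel_subset_topspace[of k]
          by (auto simp: \<rho>_def err_def F'_skel)
      next
        case (2 \<Psi> v)
        have v: "v \<in> cell_disk k" using 2 by auto
        have "d x = norm v" unfolding d_def 2(3) using 2 v by (subst attach_cell) auto
        then have nv: "1/2 < norm v" using x by simp
        have "sgn v \<in> cell_span k" using v by (simp add: sgn_div_norm cell_span_scaleR)
        moreover have "norm (sgn v) = 1" using nv by (auto simp: norm_sgn)
        ultimately have sv: "sgn v \<in> cell_sphere k" "sgn v \<in> cell_disk k" by simp_all
        have \<rho>: "\<rho> (r, x) = \<Psi> (linepath v (sgn v) r)" for r
          unfolding \<rho>_def 2(3) using retract_homotopy_cell[OF 2(1) v] push_out_linepath[OF nv] by simp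
        have mem: "\<Psi> (sgn v) \<in> skel k" using cell_sphere_in_skel[OF 2(1) sv(1)] .
        have "err x = h \<Psi> v - h \<Psi> (sgn v)"
          unfolding err_def 2(3) using 2 v by (subst attach_cell) (auto simp: push_out_sphere push_out_1[OF nv])
        \<comment> \<open>The degenerate triangle \<open>0\<close>, \<open>v\<close>,
          \<open>sgn v\<close>: the flow line accounts for the difference between the two
          radii.\<close>
        moreover have "cone \<Psi> v + z (path_simplex (\<lambda>r. \<Psi> (linepath v (sgn v) r))) = cone \<Psi> (sgn v)"
          using cocycle_triangle[OF z cell_map[OF 2(1)] convex_cell_disk zero_in_cell_disk v sv(2)]
          by (simp add: cone_def linepath_def)
        moreover have "F (\<Psi> (sgn v)) = h \<Psi> (sgn v) - cone \<Psi> (sgn v)"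
          using F'_cell[OF 2(1) sv(2)] F'_skel[OF mem] by simp
        moreover have "F' x = h \<Psi> v - cone \<Psi> v" using F'_cell[OF 2(1) v] 2(3) by simp
        ultimately show ?thesis using mem by (simp add: \<rho> linepath_1')
      qed
      define T where "T y = \<rho> (snd y, \<sigma> (fst y))" for y
      have T: "continuous_map (top_of_set (J \<times> {0..1})) K T"
      proof -
        have "continuous_map (top_of_set (J \<times> {0..1})) (top_of_set {0..1}) (\<lambda>y. snd y :: real)"
          by (auto simp: continuous_on_snd)
        moreover have "continuous_map (top_of_set (J \<times> {0..1::real})) (subtopology K (skel (Suc k))) (\<lambda>y. \<sigma> (fst y))"
          using \<sigma> unfolding pathin_def
          by (rule continuous_map_compose_on) (auto simp: continuous_on_fst J_def)
        ultimately have "continuous_map (top_of_set (J \<times> {0..1::real}))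
            (prod_topology (top_of_set {0..1}) (subtopology K (skel (Suc k)))) (\<lambda>y. (snd y, \<sigma> (fst y)))"
          by (rule continuous_map_pairedI)
        from continuous_map_compose[OF this continuous_map_retract_homotopy]
        show ?thesis by (simp add: T_def[abs_def] \<rho>_def o_def)
      qed
      \<comment> \<open>The pushed path is known to lie in \<open>skel k\<close> only for times in
        \<open>J = {a..b}\<close>. Clamping the time to \<open>J\<close> gives a path on the whole
        unit interval, to which the hypothesis on \<open>F\<close> applies.\<close>
      define \<tau> where "\<tau> t = T (max a (min b t), 1)" for t
      have \<tau>: "pathin (subtopology K (skel k)) \<tau>"
        unfolding pathin_def continuous_map_in_subtopology
      proof
        show "continuous_map (top_of_set {0..1}) K \<tau>"
          unfolding \<tau>_def[abs_def]
          by (rule continuous_map_compose_on[OF T]) (use ab in \<open>auto simp: J_eq intro!: continuous_intros\<close>)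
        have "T (t, 1) \<in> skel k" if "t \<in> J" for t
          using key[of "\<sigma> t"] e(2) \<sigma>_skel that by (auto simp: T_def J_def)
        then show "\<tau> \<in> topspace (top_of_set {0..1}) \<rightarrow> skel k"
          unfolding \<tau>_def using ab by (auto simp: J_eq)
      qed
      have \<tau>_J: "\<tau> t = T (t, 1)" if "t \<in> J" for t using that by (simp add: \<tau>_def J_eq)
      have \<tau>K: "pathin K \<tau>" using \<tau> by (auto simp: pathin_def continuous_map_in_subtopology)
      define const where "const = real_of_int (z (path_simplex (\<lambda>r. \<sigma> (linepath 0 t0 r))) - z (path_simplex (\<lambda>r. \<tau> (linepath 0 t0 r))))"
      have eq_G: "?G t = (F (\<tau> t) + z (path_simplex (\<lambda>r. \<tau> (linepath 0 t r)))) + err (\<sigma> t) + const" if t: "t \<in> J" for t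
      proof -
        have t01: "t \<in> {0..1}" using t by (simp add: J_def)
        have "z (path_simplex (\<lambda>r. T (linepath t0 t r, 0))) + z (path_simplex (\<lambda>r. T (t, r)))
            = z (path_simplex (\<lambda>r. T (t0, r))) + z (path_simplex (\<lambda>r. T (linepath t0 t r, 1)))"
          by (rule cocycle_square[OF z T J t])
        \<comment> \<open>The flow line at \<open>t0\<close> is constant because
          \<open>\<sigma> t0\<close> lies in \<open>skel k\<close>. Hence, in the square swept out
          by the flow, the segments of \<open>\<sigma>\<close> and \<open>\<tau>\<close> differ only
          by the flow line at \<open>t\<close>.\<close>
        moreover have "z (path_simplex (\<lambda>r. T (t0, r))) = 0"
          using 1 cocycle_const[OF z, of "\<sigma> t0"] skel_subset_topspace[of k] by (auto simp: T_def \<rho>_def)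
        moreover have "T (s, 0) = \<sigma> s" if "s \<in> J" for s
          using \<sigma>_skel[of s] that retract_homotopy_0 by (simp add: T_def \<rho>_def J_def)
        then have "z (path_simplex (\<lambda>r. T (linepath t0 t r, 0))) = z (path_simplex (\<lambda>r. \<sigma> (linepath t0 t r)))"
          using J_lin[of t0 e t] J t by (intro cocycle_cong) (simp add: J_def)
        moreover have "z (path_simplex (\<lambda>r. T (linepath t0 t r, 1))) = z (path_simplex (\<lambda>r. \<tau> (linepath t0 t r)))"
          using J_lin[of t0 e t] J t \<tau>_J by (intro cocycle_cong) (simp add: J_def)
        moreover have "z (path_simplex (\<lambda>r. \<tau> (linepath 0 t0 r))) + z (path_simplex (\<lambda>r. \<tau> (linepath t0 t r)))
            = z (path_simplex (\<lambda>r. \<tau> (linepath 0 t r)))"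
          using t0 t01 by (intro cocycle_subpath[OF z \<tau>K]) auto
        moreover have "F' (\<sigma> t) = F (\<tau> t) + z (path_simplex (\<lambda>r. T (t, r))) + err (\<sigma> t)"
          using key[of "\<sigma> t"] e(2) \<sigma>_skel t \<tau>_J by (simp add: T_def J_def)
        ultimately show ?thesis using G[OF t01] by (simp add: const_def)
      qed
      have "continuous_on J (\<lambda>t. (F (\<tau> t) + z (path_simplex (\<lambda>r. \<tau> (linepath 0 t r)))) + err (\<sigma> t) + const)"
      proof (rule continuous_on_add[OF continuous_on_add continuous_on_const])
        show "continuous_on J (\<lambda>t. err (\<sigma> t))"
          using cont_err by (rule continuous_on_subset) (simp add: J_def)
        have "continuous_on {0..1} (\<lambda>t. F (\<tau> t) + z (path_simplex (\<lambda>r. \<tau> (linepath 0 t r))))"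
          by (rule primitive_along_pathsD[OF F \<tau>])
        then show "continuous_on J (\<lambda>t. F (\<tau> t) + z (path_simplex (\<lambda>r. \<tau> (linepath 0 t r))))"
          by (rule continuous_on_subset) (simp add: J_def)
      qed
      then have "continuous_on J ?G" by (rule continuous_on_eq) (rule eq_G[symmetric])
      with e(1) show ?thesis by (auto simp: J_def)
    qed
  qed
  then have "primitive_along_paths z (subtopology K (skel (Suc k))) F'"
    unfolding primitive_along_paths_def by blast
  with F'_skel cont_h F'_cell show ?thesis
    unfolding cone_def by (intro exI[of _ F'] exI[of _ h]) blast
qed

text \<open>On each closed cell newly attached, the primitive differs from a continuous function by
  integers, which \<open>RP1_class\<close> does not see. The circle of the construction is thus
  realised directly as the projective line.\<close>

lemma primitive_exists:
  assumes z: "z \<in> cocycles K 1"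
  obtains F where "primitive_along_paths z K F" "continuous_map K RP2 (\<lambda>x. RP1_class (F x))"
proof -
  have "\<exists>F. primitive_along_paths z (subtopology K (skel k)) F \<and>
      continuous_map (subtopology K (skel k)) RP2 (\<lambda>x. RP1_class (F x))" for k
  proof (induction k)
    case 0
    have "\<not> pathin (subtopology K (skel 0)) \<sigma>" for \<sigma>
      using null_topspace_iff_trivial[of "top_of_set {0..1::real}"] by (auto simp: skel_0 pathin_def)
    moreover have "continuous_map (subtopology K (skel 0)) RP2 g" for g
      by (rule continuous_map_from_skel) simp
    ultimately show ?case by (auto simp: primitive_along_paths_def)
  next
    case (Suc k)
    then obtain F where F: "primitive_along_paths z (subtopology K (skel k)) F"
      "continuous_map (subtopology K (skel k)) RP2 (\<lambda>x. RP1_class (F x))" by blast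
    obtain F' h where F': "\<forall>x\<in>skel k. F' x = F x"
      "primitive_along_paths z (subtopology K (skel (Suc k))) F'"
      and h: "\<forall>\<Psi>. (k, \<Psi>) \<in> C \<longrightarrow> continuous_on (cell_disk k) (h \<Psi> :: complex \<Rightarrow> real) \<and>
        (\<forall>v\<in>cell_disk k. F' (\<Psi> v) = h \<Psi> v - real_of_int (z (path_simplex (\<lambda>r. \<Psi> (r *\<^sub>R v)))))"
      using primitive_extension[OF z F(1)] by blast
    have F'_class: "RP1_class (F' (\<Psi> v)) = RP1_class (h \<Psi> v)" if "(k, \<Psi>) \<in> C" "v \<in> cell_disk k" for \<Psi> v
      using RP1_class_shift[of "h \<Psi> v" "- z (path_simplex (\<lambda>r. \<Psi> (r *\<^sub>R v)))"] h that by simp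
    have "continuous_map (subtopology K (skel (Suc k))) RP2 (\<lambda>x. RP1_class (F' x))"
    proof (rule continuous_map_from_skel)
      fix n \<Psi> assume c: "(n, \<Psi>) \<in> C" "n < Suc k"
      show "continuous_map (top_of_set (cell_disk n)) RP2 (\<lambda>v. RP1_class (F' (\<Psi> v)))"
      proof (cases "n = k")
        case True
        have "continuous_map (top_of_set (cell_disk k)) RP2 (\<lambda>v. RP1_class (h \<Psi> v))"
          by (rule continuous_map_compose_on[of UNIV]) (use continuous_map_RP1_class h c True in auto)
        then show ?thesis
          unfolding True by (rule continuous_map_eq) (use F'_class c True in auto)
      next
        case False
        then have "n < k" using c by simp
        have "continuous_map (top_of_set (cell_disk n)) RP2 ((\<lambda>x. RP1_class (F x)) \<circ> \<Psi>)"
          using cell_map_skel[OF c(1) \<open>n < k\<close>] F(2) by (rule continuous_map_compose)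
        then show ?thesis
          by (rule continuous_map_eq) (use cell_disk_in_skel[OF c(1) _ \<open>n < k\<close>] F'(1) in auto)
      qed
    qed
    with F'(2) show ?case by blast
  qed
  \<comment> \<open>By the indexing of \<open>skel\<close>, the stage 3 contains the cells of
    dimension up to 2, that is, all of \<open>K\<close>.\<close>
  from this[of 3] show thesis
    using that by (auto simp: skel_3)
qed

end

section \<open>Passage from the CW structure to plane cells\<close>

definition plane_coords :: "complex \<Rightarrow> nat \<Rightarrow> real" where
  "plane_coords w = (\<lambda>i. if i = 0 then Re w else if i = 1 then Im w else 0)"

lemma continuous_on_plane_coords: "continuous_on S plane_coords"
  unfolding plane_coords_def
  by (intro continuous_on_coordinatewise_then_product continuous_on_if_const continuous_intros)

lemma inj_plane_coords: "plane_coords v = plane_coords w \<Longrightarrow> v = w"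
  by (metis complex_eqI one_neq_zero plane_coords_def)

lemma sum_plane_coords:
  assumes "n \<le> 2" "w \<in> cell_span n"
  shows "(\<Sum>i<n. (plane_coords w i)\<^sup>2) = (norm w)\<^sup>2" "\<forall>i\<ge>n. plane_coords w i = 0"
proof -
  consider "n = 0" | "n = 1" | "n = 2" using assms(1) by linarith
  then have "(\<Sum>i<n. (plane_coords w i)\<^sup>2) = (norm w)\<^sup>2 \<and> (\<forall>i\<ge>n. plane_coords w i = 0)"
  proof cases
    case 1
    then show ?thesis using assms(2) by (simp add: plane_coords_def cell_span_def cmod_power2)
  next
    case 2
    then show ?thesis using assms(2) by (simp add: plane_coords_def cell_span_def cmod_power2)
  next
    case 3
    moreover have "{..<2::nat} = {0, 1}" by auto
    ultimately show ?thesis by (simp add: plane_coords_def cmod_power2)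
  qed
  then show "(\<Sum>i<n. (plane_coords w i)\<^sup>2) = (norm w)\<^sup>2" "\<forall>i\<ge>n. plane_coords w i = 0" by auto
qed

lemma plane_coords_in_cell_iff:
  assumes "n \<le> 2" "w \<in> cell_span n"
  shows "plane_coords w \<in> cw_disk n \<longleftrightarrow> w \<in> cell_disk n"
    "plane_coords w \<in> cw_ball n \<longleftrightarrow> w \<in> cell_ball n"
    "plane_coords w \<in> cw_sphere n \<longleftrightarrow> w \<in> cell_sphere n"
  using sum_plane_coords[OF assms] assms(2)
  by (auto simp: cw_disk_def cw_ball_def cw_sphere_def abs_square_le_1 abs_square_less_1 abs_square_eq_1)

lemma plane_coords_surj:
  assumes "n \<le> 2" "x \<in> cw_ball n"
  obtains w where "w \<in> cell_ball n" "x = plane_coords w"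
proof -
  define w where "w = Complex (x 0) (x 1)"
  have zero: "\<forall>i\<ge>n. x i = 0" using assms(2) by (simp add: cw_ball_def)
  have "x i = plane_coords w i" for i
    using zero assms(1) by (auto simp: plane_coords_def w_def)
  then have x: "x = plane_coords w" by auto
  have "w \<in> cell_span n" using zero by (auto simp: cell_span_def w_def)
  then have "w \<in> cell_ball n" using plane_coords_in_cell_iff(2)[OF assms(1)] assms(2) x by simp
  then show thesis using x that by blast
qed

text \<open>The characteristic maps are composed with \<open>plane_coords\<close>, which matches the
  disks, balls and spheres of dimension at most 2. Uniqueness in the partition identifies the cell
  of a point, and injectivity on the ball then its coordinate.\<close>

lemma finite_CW_complex_2_imp_finite_2_complex:
  assumes "finite_CW_complex 2 K"
  obtains C where "finite_2_complex K C"
proof -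
  obtain C where C: "finite C" and all_cells: "\<forall>(n, \<Phi>) \<in> C. n \<le> 2 \<and>
      continuous_map (subtopology (powertop_real UNIV) (cw_disk n)) K \<Phi> \<and> inj_on \<Phi> (cw_ball n) \<and>
      \<Phi> ` cw_sphere n \<subseteq> \<Union> {\<Psi> ` cw_ball m | m \<Psi>. (m, \<Psi>) \<in> C \<and> m < n}"
    and part: "\<forall>x \<in> topspace K. \<exists>!c \<in> C. x \<in> snd c ` cw_ball (fst c)"
    using assms unfolding finite_CW_complex_def by blast
  have cell: "n \<le> 2 \<and>
      continuous_map (subtopology (powertop_real UNIV) (cw_disk n)) K \<Phi> \<and> inj_on \<Phi> (cw_ball n) \<and>
      \<Phi> ` cw_sphere n \<subseteq> \<Union> {\<Psi> ` cw_ball m | m \<Psi>. (m, \<Psi>) \<in> C \<and> m < n}"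
    if "(n, \<Phi>) \<in> C" for n \<Phi>
    using bspec[OF all_cells that] by (simp only: prod.case)
  define D where "D = (\<lambda>c. (fst c, snd c \<circ> plane_coords)) ` C"
  have D: "\<exists>\<Phi>. (n, \<Phi>) \<in> C \<and> \<Psi> = \<Phi> \<circ> plane_coords" if "(n, \<Psi>) \<in> D" for n \<Psi>
    using that by (auto simp: D_def)
  have DI: "(n, \<Phi> \<circ> plane_coords) \<in> D" if "(n, \<Phi>) \<in> C" for n \<Phi>
    unfolding D_def using that by (rule rev_image_eqI) simp
  have cont: "continuous_map (top_of_set (cell_disk n)) K (\<Phi> \<circ> plane_coords)" if c: "(n, \<Phi>) \<in> C" for n \<Phi>
  proof -
    have "continuous_map (top_of_set (cw_disk n)) K \<Phi>"
      using cell[OF c] by (simp add: euclidean_product_topology)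
    then have "continuous_map (top_of_set (cell_disk n)) K (\<lambda>w. \<Phi> (plane_coords w))"
      using plane_coords_in_cell_iff(1)[of n] cell[OF c]
      by (intro continuous_map_compose_on[OF _ continuous_on_plane_coords]) auto
    then show ?thesis by (simp add: o_def)
  qed
  have "finite_2_complex K D"
  proof
    show "Hausdorff_space K" using assms by (simp add: finite_CW_complex_def)
    show "finite D" using C by (simp add: D_def)
    show "continuous_map (top_of_set (cell_disk n)) K \<Psi>" "n \<le> 2" if "(n, \<Psi>) \<in> D" for n \<Psi>
      using D[OF that] cont cell by auto
    show "\<exists>m \<Psi>' w. (m, \<Psi>') \<in> D \<and> m < n \<and> w \<in> cell_ball m \<and> \<Psi> v = \<Psi>' w"
      if \<Psi>: "(n, \<Psi>) \<in> D" and v: "v \<in> cell_sphere n" for n \<Psi> v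
    proof -
      obtain \<Phi> where \<Phi>: "(n, \<Phi>) \<in> C" "\<Psi> = \<Phi> \<circ> plane_coords" using D[OF \<Psi>] by blast
      then have "plane_coords v \<in> cw_sphere n"
        using v cell plane_coords_in_cell_iff(3)[of n v] by auto
      then have "\<Psi> v \<in> \<Union> {\<Psi> ` cw_ball m | m \<Psi>. (m, \<Psi>) \<in> C \<and> m < n}"
        using cell[OF \<Phi>(1)] imageI[of "plane_coords v" "cw_sphere n" \<Phi>]
        unfolding \<Phi>(2) comp_apply by blast
      then obtain m \<Phi>' y where m: "(m, \<Phi>') \<in> C" "m < n" "y \<in> cw_ball m" "\<Psi> v = \<Phi>' y" by blast
      have "m \<le> 2" using cell[OF m(1)] by simp
      then obtain w where "w \<in> cell_ball m" "y = plane_coords w" using m(3) by (rule plane_coords_surj)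
      then show ?thesis using m DI[OF m(1)] by fastforce
    qed
    show "\<exists>n \<Psi> v. (n, \<Psi>) \<in> D \<and> v \<in> cell_ball n \<and> x = \<Psi> v" if x: "x \<in> topspace K" for x
    proof -
      obtain c where "c \<in> C" "x \<in> snd c ` cw_ball (fst c)" using bspec[OF part x] by blast
      then obtain y where c: "(fst c, snd c) \<in> C" "y \<in> cw_ball (fst c)" "x = snd c y" by auto
      have "fst c \<le> 2" using cell[OF c(1)] by simp
      then obtain w where "w \<in> cell_ball (fst c)" "y = plane_coords w" using c(2) by (rule plane_coords_surj)
      then show ?thesis using c DI[OF c(1)] by fastforce
    qed
    show "n = m \<and> \<Psi> = \<Psi>' \<and> v = w"
      if \<Psi>: "(n, \<Psi>) \<in> D" and v: "v \<in> cell_ball n" and \<Psi>': "(m, \<Psi>') \<in> D" and w: "w \<in> cell_ball m"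
        and eq: "\<Psi> v = \<Psi>' w" for n \<Psi> v m \<Psi>' w
    proof -
      obtain \<Phi> where \<Phi>: "(n, \<Phi>) \<in> C" "\<Psi> = \<Phi> \<circ> plane_coords" using D[OF \<Psi>] by blast
      obtain \<Phi>' where \<Phi>': "(m, \<Phi>') \<in> C" "\<Psi>' = \<Phi>' \<circ> plane_coords" using D[OF \<Psi>'] by blast
      have n: "n \<le> 2" "m \<le> 2" using cell \<Phi>(1) \<Phi>'(1) by blast+
      have pv: "plane_coords v \<in> cw_ball n" "plane_coords w \<in> cw_ball m"
        using plane_coords_in_cell_iff(2)[of n v] plane_coords_in_cell_iff(2)[of m w] n v w by auto
      have "v \<in> cell_disk n" using v by simp
      then have "\<Psi> v \<in> topspace K"
        using continuous_map_image_subset_topspace[OF cont[OF \<Phi>(1)]] \<Phi>(2) by auto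
      then obtain c where c: "\<And>c'. c' \<in> C \<Longrightarrow> \<Psi> v \<in> snd c' ` cw_ball (fst c') \<Longrightarrow> c' = c"
        using bspec[OF part] by blast
      have "\<Psi> v \<in> \<Phi> ` cw_ball n" unfolding \<Phi>(2) comp_apply by (rule imageI[OF pv(1)])
      moreover have "\<Psi> v \<in> \<Phi>' ` cw_ball m" unfolding eq \<Phi>'(2) comp_apply by (rule imageI[OF pv(2)])
      ultimately have "(n, \<Phi>) = c" "(m, \<Phi>') = c"
        using c[OF \<Phi>(1)] c[OF \<Phi>'(1)] by simp_all
      then have "(n, \<Phi>) = (m, \<Phi>')" by simp
      moreover from this have "plane_coords v = plane_coords w"
        using cell[OF \<Phi>(1)] pv eq \<Phi>(2) \<Phi>'(2) by (auto dest: inj_onD)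
      then have "v = w" by (rule inj_plane_coords)
      ultimately show ?thesis using \<Phi>(2) \<Phi>'(2) by simp
    qed
  qed
  then show thesis by (rule that)
qed

theorem theorem3p2:
  fixes K :: "'a topology" and x0 :: 'a and \<alpha> :: "(real \<Rightarrow> 'a) \<Rightarrow> bool"
  assumes "finite_CW_complex 2 K"
    and "connected_space K"
    and "finite (cohomology_group K 2)" and "odd (card (cohomology_group K 2))"
    and "x0 \<in> topspace K"
    and "pi1_hom_Z2 K x0 \<alpha>"
  shows "\<exists>f0. continuous_map K RP2 f0 \<and> f0 ` topspace K \<noteq> topspace RP2 \<and>
              induces_on_pi1 K x0 f0 \<alpha>"
proof -
  obtain C where "finite_2_complex K C"
    using assms(1) by (rule finite_CW_complex_2_imp_finite_2_complex)
  then interpret finite_2_complex K C .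
  have "path_connected_space K" using assms(2) by (rule path_connected_space_if_connected)
  then have "\<forall>x\<in>topspace K. \<exists>g. pathin K g \<and> g 0 = x0 \<and> g 1 = x"
    using assms(5) by (simp add: path_connected_space_def)
  then obtain P where P: "\<And>x. x \<in> topspace K \<Longrightarrow> pathin K (P x) \<and> P x 0 = x0 \<and> P x 1 = x"
    by metis
  interpret pi1_hom_to_Z2 K x0 \<alpha> P
    using assms(6) P by unfold_locales
  obtain z where z: "z \<in> cocycles K 1"
    and \<alpha>: "\<And>\<gamma>. loopin K x0 \<gamma> \<Longrightarrow> \<alpha> \<gamma> \<longleftrightarrow> odd (z (path_simplex \<gamma>))"
    using integral_lift[OF assms(3,4)] by blast
  obtain F where F: "primitive_along_paths z K F" "continuous_map K RP2 (\<lambda>x. RP1_class (F x))"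
    using primitive_exists[OF z] by blast
  have "homotopic_loops_rel RP2 (RP1_class (F x0)) ((\<lambda>x. RP1_class (F x)) \<circ> \<gamma>) (\<lambda>t. RP1_class (F x0))
      \<longleftrightarrow> even (z (path_simplex \<gamma>))" if \<gamma>: "loopin K x0 \<gamma>" for \<gamma>
  proof (rule RP1_loop_nullhomotopic_iff)
    \<comment> \<open>The continuous real lift provided by the primitive. Its integer summand does
      not affect \<open>RP1_class\<close>, and over the loop it grows by the value of
      \<open>z\<close>, the number of half turns.\<close>
    let ?c = "\<lambda>t. F (\<gamma> t) + z (path_simplex (\<lambda>r. \<gamma> (linepath 0 t r)))"
    show "continuous_on {0..1} ?c"
      using F(1) \<gamma> by (intro primitive_along_pathsD) (auto simp: loopin_def)
    show "((\<lambda>x. RP1_class (F x)) \<circ> \<gamma>) t = RP1_class (?c t)" for t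
      by (simp add: RP1_class_shift)
    have "z (path_simplex (\<lambda>r. \<gamma> (linepath 0 0 r))) = 0"
      using cocycle_const[OF z assms(5)] \<gamma> by (simp add: loopin_def)
    then show "?c 1 = ?c 0 + z (path_simplex \<gamma>)"
      using \<gamma> by (simp add: loopin_def linepath_def)
    show "RP1_class (F x0) = ((\<lambda>x. RP1_class (F x)) \<circ> \<gamma>) 0"
      using \<gamma> by (simp add: loopin_def)
  qed
  then have "induces_on_pi1 K x0 (\<lambda>x. RP1_class (F x)) \<alpha>"
    unfolding induces_on_pi1_def using \<alpha> by blast
  moreover have "(\<lambda>x. RP1_class (F x)) ` topspace K \<noteq> topspace RP2"
    using RP1_class_not_surj by blast
  ultimately show ?thesis using F(2) by blast
qed

end
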